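(* Let $\gamma<0$ and $\theta>1$. Then, for any $T>0$, there is no non negative weak solution $v$ of (E) on $(0,T)$ satisfying, for some $\rho>1-\gamma$, the initial condition $v(t)\rightharpoonup\delta_1$ in $E'_{\rho,\rho-\gamma}$ as $t\to0$, and such that $$v\in C\left([0,T);\mathscr M_{\rho-1-\delta}\cap\mathscr M_{\rho-\gamma-1+\delta}\right)\quad\text{for some }\delta>0.$$
   Context: Equation (E): $$\partial_tu(t,x)+\partial_x\big(x^{1+\gamma}u(t,x)\big)+x^\gamma u(t,x)=\theta\int_x^\infty y^{\gamma-1}u(t,y)\,dy,\quad t>0,\ x>0.$$ Measures are written as if they had densities. A measure $u$ is a weak solution of (E) on $(t_0,t_1)$ if for all $\varphi\in C_c^1((t_0,t_1)\times(0,\infty))$: $$\int_0^\infty\!\!\int_0^\infty\left(\partial_t\varphi+x^{\gamma+1}\partial_x\varphi-x^\gamma\varphi\right)u(t,x)\,dx\,dt=-\theta\int_0^\infty\!\!\int_0^\infty u(t,y)y^{\gamma-1}\int_0^y\varphi(t,x)\,dx\,dy\,dt.$$ $\delta_1$ is the Dirac mass at $x=1$. For $p<q$, $E_{p,q}$ is the space of $\phi\in C^\infty(0,\infty)$ such that for every integer $k\ge0$, $\sup_{x>0}k_{p,q}(x)x^{k+1}|\phi^{(k)}(x)|<\infty$, where $k_{p,q}(x)=x^{-p}$ for $0<x\le1$ and $k_{p,q}(x)=x^{-q}$ for $x>1$, topologized by these seminorms; $E'_{p,q}$ is its dual, and $\rightharpoonup$ is weak-* convergence. $\mathscr M_\rho$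 is the space of measures $u$ on $(0,\infty)$ with $\int_0^\infty x^\rho u(x)\,dx<\infty$; continuity in time with values in $\mathscr M_\rho$ means continuity of $t\mapsto\int_0^\infty x^\rho\psi(x)u(t,x)\,dx$ for every bounded continuous $\psi$. *)

theory Defs
  imports "HOL-Probability.Probability"
begin

section \<open>Measures on the half line\<close>

text \<open>
  A nonnegative Borel measure on $(0,\infty)$ is a measure with the same measurable sets as
  \<open>half_line\<close>; its underlying space is then $(0,\infty)$, so integrals against it run over
  $(0,\infty)$ and ignore the values of the integrand at nonpositive reals.
\<close>

definition half_line :: "real measure" where
  "half_line = restrict_space borel {0<..}"

definition dirac_one :: "real measure" where
  "dirac_one = return half_line 1"

definition moment_space :: "real \<Rightarrow> real measure set" where
  "moment_space \<rho> = {\<mu>. sets \<mu> = sets half_line \<and> (\<integral>\<^sup>+ x. ennreal (x powr \<rho>) \<partial>\<mu>) < \<infinity>}"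

text \<open>The continuity clause of $C(I;\mathscr{M}_\rho)$, without membership of the values.\<close>

definition moment_continuous_on :: "real \<Rightarrow> real set \<Rightarrow> (real \<Rightarrow> real measure) \<Rightarrow> bool" where
  "moment_continuous_on \<rho> I u \<longleftrightarrow>
     (\<forall>\<psi> :: real \<Rightarrow> real. continuous_on {0<..} \<psi> \<and> bounded (\<psi> ` {0<..}) \<longrightarrow>
        continuous_on I (\<lambda>t. \<integral>x. x powr \<rho> * \<psi> x \<partial>(u t)))"

definition C_moment :: "real set \<Rightarrow> real \<Rightarrow> (real \<Rightarrow> real measure) set" where
  "C_moment I \<rho> = {u. (\<forall>t\<in>I. u t \<in> moment_space \<rho>) \<and> moment_continuous_on \<rho> I u}"


section \<open>Weak solutions\<close>

text \<open>
  Elements of $C_c^1((t_0,t_1)\times(0,\infty))$, extended by zero to the whole plane.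
\<close>

definition test_functions :: "real \<Rightarrow> real \<Rightarrow> (real \<Rightarrow> real \<Rightarrow> real) set" where
  "test_functions t0 t1 = {\<phi>.
     (\<forall>t x. (\<lambda>s. \<phi> s x) differentiable (at t) \<and> (\<lambda>y. \<phi> t y) differentiable (at x)) \<and>
     continuous_on UNIV (\<lambda>(t, x). deriv (\<lambda>s. \<phi> s x) t) \<and>
     continuous_on UNIV (\<lambda>(t, x). deriv (\<lambda>y. \<phi> t y) x) \<and>
     compact (closure {(t, x). \<phi> t x \<noteq> 0}) \<and>
     closure {(t, x). \<phi> t x \<noteq> 0} \<subseteq> {t0<..<t1} \<times> {0<..}}"

text \<open>
  The integrals against $u(t,x)\,dx\,dt$ are iterated integrals for the family $(u(t))_t$.
\<close>

definition iterated_integrable ::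
    "real \<Rightarrow> real \<Rightarrow> (real \<Rightarrow> real measure) \<Rightarrow> (real \<Rightarrow> real \<Rightarrow> real) \<Rightarrow> bool" where
  "iterated_integrable t0 t1 u f \<longleftrightarrow>
     (AE t in lborel. t \<in> {t0<..<t1} \<longrightarrow> integrable (u t) (f t)) \<and>
     set_integrable lborel {t0<..<t1} (\<lambda>t. \<integral>x. f t x \<partial>(u t))"

definition transport_term :: "real \<Rightarrow> (real \<Rightarrow> real \<Rightarrow> real) \<Rightarrow> real \<Rightarrow> real \<Rightarrow> real" where
  "transport_term \<gamma> \<phi> t x =
     deriv (\<lambda>s. \<phi> s x) t + x powr (\<gamma> + 1) * deriv (\<lambda>y. \<phi> t y) x - x powr \<gamma> * \<phi> t x"

definition fragmentation_term :: "real \<Rightarrow> (real \<Rightarrow> real \<Rightarrow> real) \<Rightarrow> real \<Rightarrow> real \<Rightarrow> real" where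
  "fragmentation_term \<gamma> \<phi> t y = y powr (\<gamma> - 1) * (LBINT x:{0<..<y}. \<phi> t x)"

text \<open>
  Bochner integrals of nonintegrable functions are zero by convention, so the existence of both
  sides of the weak formulation is required explicitly. For families that are continuous in the
  moment spaces used here, it holds automatically.
\<close>

definition nonneg_weak_solution ::
    "real \<Rightarrow> real \<Rightarrow> real \<Rightarrow> real \<Rightarrow> (real \<Rightarrow> real measure) \<Rightarrow> bool" where
  "nonneg_weak_solution \<gamma> \<theta> t0 t1 u \<longleftrightarrow>
     (\<forall>t\<in>{t0<..<t1}. sets (u t) = sets half_line) \<and>
     (\<forall>\<phi>\<in>test_functions t0 t1.
        iterated_integrable t0 t1 u (transport_term \<gamma> \<phi>) \<and>
        iterated_integrable t0 t1 u (fragmentation_term \<gamma> \<phi>) \<and>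
        (LBINT t:{t0<..<t1}. \<integral>x. transport_term \<gamma> \<phi> t x \<partial>(u t)) =
          - \<theta> * (LBINT t:{t0<..<t1}. \<integral>y. fragmentation_term \<gamma> \<phi> t y \<partial>(u t)))"


section \<open>The spaces $E_{p,q}$ and $E'_{p,q}$\<close>

definition weight :: "real \<Rightarrow> real \<Rightarrow> real \<Rightarrow> real" where
  "weight p q x = (if x \<le> 1 then x powr (- p) else x powr (- q))"

definition weighted_deriv :: "real \<Rightarrow> real \<Rightarrow> nat \<Rightarrow> (real \<Rightarrow> real) \<Rightarrow> real \<Rightarrow> real" where
  "weighted_deriv p q k \<phi> x = weight p q x * x ^ (k + 1) * \<bar>(deriv ^^ k) \<phi> x\<bar>"

text \<open>
  Functions on $(0,\infty)$ are represented by total functions whose values at nonpositive reals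
  are arbitrary. Two representatives of the same function have seminorm distance zero, so
  continuous linear functionals do not distinguish them.
\<close>

definition E :: "real \<Rightarrow> real \<Rightarrow> (real \<Rightarrow> real) set" where
  "E p q = {\<phi>. (\<forall>k. (deriv ^^ k) \<phi> differentiable_on {0<..}) \<and>
                (\<forall>k. bdd_above (weighted_deriv p q k \<phi> ` {0<..}))}"

definition E_seminorm :: "real \<Rightarrow> real \<Rightarrow> nat \<Rightarrow> (real \<Rightarrow> real) \<Rightarrow> real" where
  "E_seminorm p q k \<phi> = (SUP x\<in>{0<..}. weighted_deriv p q k \<phi> x)"

definition E_topology :: "real \<Rightarrow> real \<Rightarrow> (real \<Rightarrow> real) topology" where
  "E_topology p q = topology_generated_by
     {{\<psi> \<in> E p q. E_seminorm p q k (\<lambda>x. \<psi> x - \<phi> x) < r} | \<phi> k r. \<phi> \<in> E p q \<and> 0 < r}"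

text \<open>
  Functionals are made extensional on $E_{p,q}$, so that the weak-* topology is a subspace
  of the library's product topology.
\<close>

definition E_dual :: "real \<Rightarrow> real \<Rightarrow> ((real \<Rightarrow> real) \<Rightarrow> real) set" where
  "E_dual p q = {F \<in> extensional (E p q).
     (\<forall>\<phi>\<in>E p q. \<forall>\<psi>\<in>E p q. F (\<lambda>x. \<phi> x + \<psi> x) = F \<phi> + F \<psi>) \<and>
     (\<forall>c. \<forall>\<phi>\<in>E p q. F (\<lambda>x. c * \<phi> x) = c * F \<phi>) \<and>
     continuous_map (E_topology p q) euclideanreal F}"

definition weak_star_topology :: "real \<Rightarrow> real \<Rightarrow> ((real \<Rightarrow> real) \<Rightarrow> real) topology" where
  "weak_star_topology p q =
     subtopology (product_topology (\<lambda>_. euclideanreal) (E p q)) (E_dual p q)"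

definition measure_functional :: "real \<Rightarrow> real \<Rightarrow> real measure \<Rightarrow> (real \<Rightarrow> real) \<Rightarrow> real" where
  "measure_functional p q \<mu> = (\<lambda>\<phi>\<in>E p q. \<integral>x. \<phi> x \<partial>\<mu>)"

text \<open>
  Weak-* convergence in $E'_{p,q}$ of measures. For a measure to define a functional, all elements
  of $E_{p,q}$ have to be integrable; membership of the functional in the dual is part of
  \<^const>\<open>limitin\<close> for the weak-* topology.
\<close>

definition weak_star_tendsto ::
    "real \<Rightarrow> real \<Rightarrow> (real \<Rightarrow> real measure) \<Rightarrow> real measure \<Rightarrow> real filter \<Rightarrow> bool" where
  "weak_star_tendsto p q u \<mu> \<F> \<longleftrightarrow>
     (\<forall>\<phi>\<in>E p q. integrable \<mu> \<phi>) \<and>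
     (\<forall>\<^sub>F t in \<F>. \<forall>\<phi>\<in>E p q. integrable (u t) \<phi>) \<and>
     limitin (weak_star_topology p q)
       (\<lambda>t. measure_functional p q (u t)) (measure_functional p q \<mu>) \<F>"

end

theory Submission
  imports Defs "HOL-Real_Asymp.Real_Asymp"
begin

text \<open>
  Let \<open>L \<psi> = x\<^bsup>\<gamma>+1\<^esup> \<psi>' - x\<^sup>\<gamma> \<psi> + \<theta> x\<^bsup>\<gamma>-1\<^esup> \<integral>\<^sub>0\<^sup>x \<psi>\<close>, so that a weak solution satisfies
  \<open>d/dt \<integral> \<psi> dv = \<integral> L \<psi> dv\<close>. For \<open>\<theta> > 1\<close> there is a bump \<open>\<psi> \<ge> 0\<close> with compact support in
  \<open>(0,\<infinity>)\<close> and \<open>L \<psi> \<ge> \<nu> \<psi>\<close> for some \<open>\<nu> > 0\<close>. By scaling, \<open>\<psi>\<^sub>\<epsilon> = \<psi>(x/\<epsilon>)\<close> satisfies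
  \<open>L \<psi>\<^sub>\<epsilon> \<ge> \<nu> \<epsilon>\<^sup>\<gamma> \<psi>\<^sub>\<epsilon>\<close>, so the mass at size \<open>\<epsilon>\<close> grows at least like \<open>exp (\<nu> \<epsilon>\<^sup>\<gamma> t)\<close>. The fragmentation of
  the mass near \<open>1\<close> provides an initial amount of order \<open>\<epsilon>\<close> at that size, while a finite moment
  of order \<open>s\<close> bounds it by a multiple of \<open>\<epsilon>\<^bsup>-s\<^esup>\<close>. As \<open>\<gamma> < 0\<close>, this is impossible for small \<open>\<epsilon>\<close>.
\<close>

section \<open>Truncated powers and weak derivatives\<close>

lemma DERIV_max_0_power:
  fixes y :: real
  assumes "k > 0"
  shows "((\<lambda>y. (max 0 y) ^ Suc k) has_real_derivative real (Suc k) * (max 0 y) ^ k) (at y)"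
proof -
  consider "y < 0" | "y = 0" | "y > 0" by linarith
  then show ?thesis
  proof cases
    case 1
    have "((\<lambda>y. 0) has_real_derivative real (Suc k) * (max 0 y) ^ k) (at y)"
      using 1 assms by (simp add: max_def zero_power)
    then show ?thesis
      by (rule has_field_derivative_transform_within_open[where S = "{..<0}"]) (use 1 in auto)
  next
    case 2
    \<comment> \<open>At the kink Caratheodory's criterion applies: the slope function
      \<open>(max 0 z) ^ k\<close> is continuous and, as \<open>k > 0\<close>, vanishes at
      \<open>0\<close>.\<close>
    have "(max 0 z) ^ Suc k - (max 0 0) ^ Suc k = (max 0 z) ^ k * (z - 0)" for z :: real
      using assms by (auto simp: max_def)
    moreover have "isCont (\<lambda>z. (max 0 z) ^ k) (0::real)"
      by (intro continuous_intros)
    ultimately show ?thesis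
      unfolding 2 CARAT_DERIV using assms by (intro exI[of _ "\<lambda>z. (max 0 z) ^ k"]) auto
  next
    case 3
    have "((\<lambda>y. y ^ Suc k) has_real_derivative real (Suc k) * (max 0 y) ^ k) (at y)"
      using DERIV_pow[of "Suc k" y] 3 by (simp add: max_def del: power_Suc)
    then show ?thesis
      by (rule has_field_derivative_transform_within_open[where S = "{0<..}"]) (use 3 in auto)
  qed
qed

text \<open>The du Bois-Reymond lemma: subtracting a primitive of \<open>B\<close> from
  \<open>A\<close> leaves a function with zero weak derivative, hence a locally constant one. It
  turns the weak formulation into a pointwise differential equation in time.\<close>

lemma weak_derivative_imp_DERIV:
  fixes A B :: "real \<Rightarrow> real"
  assumes A: "continuous_on {t0<..<t1} A" and B: "continuous_on {t0<..<t1} B"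
    and weak: "\<And>h h' a b. \<lbrakk>t0 < a; a < b; b < t1; \<forall>t. (h has_real_derivative h' t) (at t);
      continuous_on UNIV h'; \<forall>t. t \<notin> {a..b} \<longrightarrow> h t = 0\<rbrakk> \<Longrightarrow>
      (LBINT t:{t0<..<t1}. h' t * A t) = - (LBINT t:{t0<..<t1}. h t * B t)"
    and t: "t \<in> {t0<..<t1}"
  shows "(A has_real_derivative B t) (at t)"
proof -
  \<comment> \<open>A compact neighbourhood of \<open>t\<close>: \<open>A\<close> and
    \<open>B\<close> may be unbounded near \<open>t0\<close> and \<open>t1\<close>, so the whole
    argument takes place on \<open>{a..b}\<close>.\<close>
  define a b where "a = (t0 + t) / 2" and "b = (t + t1) / 2"
  have ab: "t0 < a" "a < t" "t < b" "b < t1" using t by (auto simp: a_def b_def)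
  have sub: "{a..b} \<subseteq> {t0<..<t1}" using ab by auto
  note [continuous_intros] = continuous_on_subset[OF A sub] continuous_on_subset[OF B sub]
  define P where "P = (\<lambda>s. integral {a..s} B)"
  have P: "(P has_vector_derivative B s) (at s within {a..b})" if "s \<in> {a..b}" for s
    unfolding P_def by (rule integral_has_vector_derivative) (use that in \<open>auto intro: continuous_intros\<close>)
  have Pcont [continuous_intros]: "continuous_on {a..b} P"
    using P by (rule continuous_on_vector_derivative)
  define D where "D = (\<lambda>s. A s - P s)"
  have Dcont [continuous_intros]: "continuous_on {a..b} D"
    unfolding D_def by (intro continuous_intros)
  \<comment> \<open>The weight vanishes at \<open>a\<close> and \<open>b\<close>, so that
    \<open>k\<close> below extends continuously by zero, and is positive in between, so that a
    vanishing weighted square forces \<open>D = c\<close>. The constant \<open>c\<close> is the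
    \<open>w\<close>-weighted mean of \<open>D\<close>, which is what gives \<open>k\<close> mean
    zero.\<close>
  define w where "w = (\<lambda>s. (s - a) * (b - s))"
  have wcont [continuous_intros]: "continuous_on S w" for S
    unfolding w_def by (intro continuous_intros)
  have wnn: "w s \<ge> 0" if "s \<in> {a..b}" for s using that by (auto simp: w_def)
  have wint: "integral {a..b} w > 0"
  proof -
    have "integral {a..b} w \<noteq> 0"
    proof
      assume "integral {a..b} w = 0"
      then have "\<forall>s\<in>cbox a b. w s = 0"
        using integral_cbox_eq_0_iff[of a b w] wcont wnn ab by (auto simp: box_real)
      moreover have "w t > 0" using ab by (auto simp: w_def)
      ultimately show False using ab by force
    qed
    moreover have "integral {a..b} w \<ge> 0"
      by (rule integral_nonneg) (auto intro: integrable_continuous_interval continuous_intros wnn)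
    ultimately show ?thesis by linarith
  qed
  define c where "c = integral {a..b} (\<lambda>s. D s * w s) / integral {a..b} w"
  \<comment> \<open>Testing with a primitive of \<open>k\<close>, which has mean zero, gives
    \<open>\<integral> k * D = 0\<close>, that is \<open>\<integral> (D - c)\<^sup>2 * w = 0\<close>, and so \<open>A - P\<close> is constant.\<close>
  define k where "k = (\<lambda>s. if s \<in> {a..b} then (D s - c) * w s else 0)"
  have kcont_ab: "continuous_on {a..b} k"
    unfolding k_def by (rule continuous_on_eq[of _ "\<lambda>s. (D s - c) * w s"]) (auto intro!: continuous_intros)
  have kcont: "continuous_on UNIV k"
  proof -
    have "continuous_on ({a..b} \<union> ({..a} \<union> {b..})) k"
    proof (rule continuous_on_closed_Un[OF _ _ kcont_ab])
      show "continuous_on ({..a} \<union> {b..}) k"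
        by (rule continuous_on_eq[of _ "\<lambda>_. 0"]) (use ab in \<open>auto simp: k_def w_def\<close>)
    qed (auto intro: closed_Un)
    moreover have "{a..b} \<union> ({..a} \<union> {b..}) = UNIV" by auto
    ultimately show ?thesis by simp
  qed
  have kint: "integral {a..b} k = 0"
  proof -
    have "integral {a..b} k = integral {a..b} (\<lambda>s. D s * w s - c * w s)"
      by (rule integral_cong) (auto simp: k_def algebra_simps)
    also have "\<dots> = integral {a..b} (\<lambda>s. D s * w s) - c * integral {a..b} w"
      by (subst integral_diff) (auto intro!: integrable_continuous_interval continuous_intros)
    also have "\<dots> = 0" using wint by (simp add: c_def)
    finally show ?thesis .
  qed
  \<comment> \<open>Starting the primitive at \<open>a - 1\<close> makes its derivative two-sided at
    \<open>a\<close> as well. It returns to zero beyond \<open>b\<close> because \<open>k\<close>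
    has mean zero.\<close>
  define h where "h = (\<lambda>s. integral {a-1..s} k)"
  have kint_on [simp]: "k integrable_on {x..y}" for x y
    by (rule integrable_continuous_interval) (rule continuous_on_subset[OF kcont], simp)
  have chi0: "h s = 0" if "s \<notin> {a..b}" for s
  proof (cases "s < a")
    case True
    have "h s = integral {a-1..s} (\<lambda>_. 0)" unfolding h_def
      by (rule integral_cong) (use True in \<open>auto simp: k_def\<close>)
    then show ?thesis by simp
  next
    case False
    with that have s: "s > b" by auto
    have "h s = integral {a-1..a} k + integral {a..s} k" unfolding h_def
      by (subst Henstock_Kurzweil_Integration.integral_combine) (use s ab in auto)
    also have "integral {a..s} k = integral {a..b} k + integral {b..s} k"
      by (subst Henstock_Kurzweil_Integration.integral_combine) (use s ab in auto)
    also have "integral {a-1..a} k = integral {a-1..a} (\<lambda>_. 0)"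
      by (rule integral_cong) (auto simp: k_def w_def)
    also have "integral {b..s} k = integral {b..s} (\<lambda>_. 0)"
      by (rule integral_cong) (auto simp: k_def w_def)
    finally show ?thesis by (simp add: kint)
  qed
  have chi_deriv: "(h has_real_derivative k s) (at s)" for s
  proof (cases "s < a")
    case True
    have "((\<lambda>_. 0) has_real_derivative k s) (at s)" using True by (simp add: k_def)
    then show ?thesis
      by (rule has_field_derivative_transform_within_open[where S = "{..<a}"])
        (use True chi0 in auto)
  next
    case False
    have "(h has_vector_derivative k s) (at s within {a-1..s+1})" unfolding h_def
      by (rule integral_has_vector_derivative) (use False kcont continuous_on_subset in auto)
    moreover have "at s within {a-1..s+1} = at s"
      by (rule at_within_interior) (use False in auto)
    ultimately show ?thesis by (simp add: has_real_derivative_iff_has_vector_derivative)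
  qed
  have chicont [continuous_intros]: "continuous_on S h" for S
    by (meson DERIV_continuous_on chi_deriv has_field_derivative_at_within)
  have to_int: "(LBINT s:{t0<..<t1}. F s) = integral {a..b} F"
    if F: "continuous_on {a..b} F" "\<And>s. s \<notin> {a..b} \<Longrightarrow> F s = 0" for F :: "real \<Rightarrow> real"
  proof -
    have "(LBINT s:{t0<..<t1}. F s) = (LBINT s:{a..b}. F s)"
      unfolding set_lebesgue_integral_def
      by (rule Bochner_Integration.integral_cong) (use sub F(2) in \<open>auto simp: indicator_def\<close>)
    also have "\<dots> = integral {a..b} F"
      by (rule set_borel_integral_eq_integral) (rule borel_integrable_atLeastAtMost', rule F)
    finally show ?thesis .
  qed
  have "(LBINT t:{t0<..<t1}. k t * A t) = - (LBINT t:{t0<..<t1}. h t * B t)"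
    by (rule weak[of a b]) (use ab chi_deriv kcont chi0 in auto)
  moreover have "(LBINT t:{t0<..<t1}. k t * A t) = integral {a..b} (\<lambda>s. k s * A s)"
    by (rule to_int) (intro continuous_intros kcont_ab, auto simp: k_def)
  moreover have "(LBINT t:{t0<..<t1}. h t * B t) = integral {a..b} (\<lambda>s. h s * B s)"
    by (rule to_int) (auto intro!: continuous_intros simp: chi0)
  ultimately have 1: "integral {a..b} (\<lambda>s. k s * A s) = - integral {a..b} (\<lambda>s. h s * B s)" by simp
  \<comment> \<open>Integration by parts; the boundary terms drop out because \<open>h b = 0\<close>
    and \<open>P a = 0\<close>. Together with \<open>1\<close> this makes the integrals of
    \<open>k * A\<close> and \<open>k * P\<close> equal.\<close>
  have "((\<lambda>s. k s * P s + h s * B s) has_integral h b * P b - h a * P a) {a..b}"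
  proof (rule fundamental_theorem_of_calculus)
    fix s assume s: "s \<in> {a..b}"
    have "(h has_vector_derivative k s) (at s within {a..b})"
      using chi_deriv[of s] has_field_derivative_at_within
        has_real_derivative_iff_has_vector_derivative by blast
    from has_vector_derivative_mult[OF this P[OF s]]
    show "((\<lambda>s. h s * P s) has_vector_derivative k s * P s + h s * B s) (at s within {a..b})"
      by (simp add: add.commute)
  qed (use ab in auto)
  moreover have "h b = 0" 
  proof -
    have "h b = integral {a-1..a} k + integral {a..b} k" unfolding h_def
      by (subst Henstock_Kurzweil_Integration.integral_combine) (use ab in auto)
    also have "integral {a-1..a} k = integral {a-1..a} (\<lambda>_. 0)"
      by (rule integral_cong) (auto simp: k_def w_def)
    finally show ?thesis by (simp add: kint)
  qed
  moreover have "P a = 0" by (simp add: P_def)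
  ultimately have "integral {a..b} (\<lambda>s. k s * P s + h s * B s) = 0"
    by (simp add: integral_unique)
  moreover have "integral {a..b} (\<lambda>s. k s * P s + h s * B s) =
      integral {a..b} (\<lambda>s. k s * P s) + integral {a..b} (\<lambda>s. h s * B s)"
    by (rule integral_add) (auto intro!: integrable_continuous_interval continuous_intros kcont_ab)
  ultimately have 2: "integral {a..b} (\<lambda>s. k s * P s) = - integral {a..b} (\<lambda>s. h s * B s)" by simp
  have "integral {a..b} (\<lambda>s. (D s - c)\<^sup>2 * w s) =
      integral {a..b} (\<lambda>s. (k s * A s - k s * P s) - c * k s)"
    by (rule integral_cong) (auto simp: k_def D_def power2_eq_square algebra_simps)
  also have "\<dots> = integral {a..b} (\<lambda>s. k s * A s) - integral {a..b} (\<lambda>s. k s * P s) - c * integral {a..b} k"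
    by (subst integral_diff integral_diff,
        (auto intro!: integrable_continuous_interval continuous_intros kcont_ab)[2])+
      simp
  also have "\<dots> = 0" using 1 2 kint by simp
  finally have "integral {a..b} (\<lambda>s. (D s - c)\<^sup>2 * w s) = 0" .
  then have z: "\<forall>s\<in>cbox a b. (D s - c)\<^sup>2 * w s = 0"
    by (subst (asm) integral_cbox_eq_0_iff[of a b, unfolded box_real])
      (use wnn ab in \<open>auto intro!: continuous_intros\<close>)
  have Dc: "A s = c + P s" if "s \<in> {a<..<b}" for s
  proof -
    have "w s > 0" using that by (auto simp: w_def)
    moreover have "(D s - c)\<^sup>2 * w s = 0" using z that by auto
    ultimately show ?thesis by (auto simp: D_def)
  qed
  have "(P has_vector_derivative B t) (at t within {a..b})" using P ab by auto
  moreover have "at t within {a..b} = at t" by (rule at_within_interior) (use ab in auto)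
  ultimately have "(P has_real_derivative B t) (at t)"
    by (simp add: has_real_derivative_iff_has_vector_derivative)
  then have "((\<lambda>s. c + P s) has_real_derivative B t) (at t)"
    by (auto intro!: derivative_eq_intros)
  then show ?thesis
    by (rule has_field_derivative_transform_within_open[where S = "{a<..<b}"]) (use ab Dc in auto)
qed

section \<open>A compactly supported bump that grows under the dual operator\<close>

text \<open>The differential inequality for \<open>G\<close> in the next construction, divided by \<open>G\<close> and multiplied by \<open>y\<^sup>2\<close>.\<close>

lemma hump_inequality:
  fixes \<theta> \<theta>1 c n p y u :: real
  assumes "0 < \<theta>1" "\<theta>1 < \<theta>" "c\<^sup>2 < 4 * \<theta>1" "0 < n" "16 / (1 - c\<^sup>2 / (4 * \<theta>1)) \<le> n"
    and p: "0 < p" "4 * n * p\<^sup>2 \<le> \<theta> - \<theta>1" and u: "0 \<le> u" "u \<le> 1" and y: "p * y = 1 - u"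
  shows "0 \<le> n\<^sup>2 * u ^ 4 + n * u\<^sup>2 - 2 * n * u - c * n * y * u\<^sup>2 + \<theta> * y\<^sup>2"
proof -
  define \<kappa> where "\<kappa> = 1 - c\<^sup>2 / (4 * \<theta>1)"
  have \<kappa>: "\<kappa> > 0" using assms by (simp add: \<kappa>_def)
  \<comment> \<open>Completing the square absorbs the cross term. It uses up
    \<open>\<theta>1 * y\<^sup>2\<close> but only the fraction \<open>1 - \<kappa>\<close> of the
    quartic term; the remainders of both pay for \<open>n\<close> below.\<close>
  have "0 \<le> (2 * \<theta>1 * y - c * n * u\<^sup>2)\<^sup>2 / (4 * \<theta>1)" using assms by simp
  also have "\<dots> = \<theta>1 * y\<^sup>2 - c * n * y * u\<^sup>2 + (1 - \<kappa>) * n\<^sup>2 * u ^ 4"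
    using assms by (simp add: \<kappa>_def field_simps power2_eq_square power4_eq_xxxx)
  finally have 1: "c * n * y * u\<^sup>2 \<le> \<theta>1 * y\<^sup>2 + (1 - \<kappa>) * n\<^sup>2 * u ^ 4" by simp
  have "n * (1 - (2 * u - u\<^sup>2)) = n * (1 - u)\<^sup>2" by (simp add: power2_eq_square algebra_simps)
  also have "\<dots> \<ge> 0" using assms by simp
  finally have 2: "2 * n * u - n * u\<^sup>2 \<le> n" by (simp add: algebra_simps)
  \<comment> \<open>For \<open>u \<ge> 1/2\<close> the quartic term suffices because
    \<open>\<kappa> * n \<ge> 16\<close>. For \<open>u < 1/2\<close> one has
    \<open>p * y > 1/2\<close>, and smallness of \<open>p\<close> makes
    \<open>(\<theta> - \<theta>1) * y\<^sup>2\<close> at least \<open>n\<close>.\<close>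
  have 3: "n \<le> \<kappa> * n\<^sup>2 * u ^ 4 + (\<theta> - \<theta>1) * y\<^sup>2"
  proof (cases "u \<ge> 1/2")
    case True
    have "16 \<le> \<kappa> * n" using assms(5) \<kappa> unfolding \<kappa>_def[symmetric]
      by (simp add: field_simps)
    then have "n * 16 \<le> n * (\<kappa> * n)" using assms by (intro mult_left_mono) auto
    then have "n \<le> \<kappa> * n\<^sup>2 * (1/2) ^ 4" by (simp add: power2_eq_square power4_eq_xxxx algebra_simps)
    also have "\<dots> \<le> \<kappa> * n\<^sup>2 * u ^ 4"
      using True \<kappa> by (intro mult_left_mono power_mono) auto
    finally show ?thesis using assms by (simp add: add_increasing2)
  next
    case False
    then have "(1/2)\<^sup>2 \<le> (p * y)\<^sup>2" unfolding y by (intro power_mono) auto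
    then have "1 \<le> 4 * p\<^sup>2 * y\<^sup>2" by (simp add: power2_eq_square algebra_simps)
    then have "n * 1 \<le> n * (4 * p\<^sup>2 * y\<^sup>2)" using assms by (intro mult_left_mono) auto
    also have "\<dots> = (4 * n * p\<^sup>2) * y\<^sup>2" by simp
    also have "\<dots> \<le> (\<theta> - \<theta>1) * y\<^sup>2" using p by (intro mult_right_mono) auto
    finally show ?thesis using \<kappa> assms by (simp add: add_increasing)
  qed
  show ?thesis using 1 2 3 by (simp add: algebra_simps)
qed

lemma set_integral_open_interval:
  fixes f :: "real \<Rightarrow> real"
  assumes "continuous_on {a..b} f"
  shows "(LBINT x:{a<..<b}. f x) = integral {a..b} f"
proof -
  have "(LBINT x:{a<..<b}. f x) = integral {a<..<b} f"
    by (rule set_borel_integral_eq_integral)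
      (rule set_integrable_subset[OF borel_integrable_atLeastAtMost'[OF assms]], auto)
  then show ?thesis by (simp add: integral_open_interval_real)
qed

text \<open>
  With \<open>y = ln x\<close> and \<open>G y = \<integral>\<^sub>0\<^sup>x \<psi>\<close>, the last claim reads
  \<open>G'' - (2 + \<mu>) G' + \<theta> G \<ge> 0\<close>, which has oscillating solutions, and hence bumps \<open>G'\<close>, when
  \<open>(2 + \<mu>)\<^sup>2 < 4 \<theta>\<close>. The choice \<open>G'/G = n (1 - p y)\<^sup>2 / y\<close> on \<open>0 < y < 1/p\<close> is explicit, and it
  makes \<open>G'\<close> vanish at both ends to an order that keeps \<open>\<psi>\<close> continuously differentiable.
\<close>

lemma fragmentation_subsolution:
  fixes \<theta> :: real
  assumes "\<theta> > 1"
  obtains \<psi> \<psi>' :: "real \<Rightarrow> real" and R \<mu> m where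
    "R > 1" "\<mu> > 0" "m > 0"
    "\<And>x. (\<psi> has_real_derivative \<psi>' x) (at x)" "continuous_on UNIV \<psi>'"
    "\<And>x. 0 \<le> \<psi> x" "\<And>x. x \<notin> {1..R} \<Longrightarrow> \<psi> x = 0"
    "\<And>x. R \<le> x \<Longrightarrow> (LBINT z:{0<..<x}. \<psi> z) = m"
    "\<And>x. 0 < x \<Longrightarrow> \<mu> * \<psi> x \<le> x * \<psi>' x - \<psi> x + \<theta> / x * (LBINT z:{0<..<x}. \<psi> z)"
proof -
  \<comment> \<open>The gap \<open>\<theta> - \<theta>1\<close> is the reserve consumed by
    \<open>hump_inequality\<close>. With \<open>c = 1 + sqrt \<theta>1\<close>, the oscillation
    condition \<open>c\<^sup>2 < 4 * \<theta>1\<close> amounts to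
    \<open>1 < sqrt \<theta>1\<close>.\<close>
  define \<theta>1 where "\<theta>1 = (1 + \<theta>) / 2"
  have th: "1 < \<theta>1" "\<theta>1 < \<theta>" using assms by (auto simp: \<theta>1_def)
  define \<mu> where "\<mu> = sqrt \<theta>1 - 1"
  define c where "c = 2 + \<mu>"
  have sq: "1 < sqrt \<theta>1" using th by simp
  have \<mu>: "\<mu> > 0" using sq by (simp add: \<mu>_def)
  have "c\<^sup>2 < (2 * sqrt \<theta>1)\<^sup>2"
    by (rule power_strict_mono) (use sq in \<open>auto simp: c_def \<mu>_def\<close>)
  then have c: "c\<^sup>2 < 4 * \<theta>1" using th by (simp add: power_mult_distrib)
  obtain j :: nat where j: "16 / (1 - c\<^sup>2 / (4 * \<theta>1)) \<le> real j" using real_arch_simple by blast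
  \<comment> \<open>The shift by three leaves powers of \<open>y\<close> of order at least
    \<open>j + 2\<close> in \<open>h\<close> and \<open>j + 1\<close> in \<open>h'\<close>, so both
    vanish at \<open>0\<close> whatever \<open>j\<close> is.\<close>
  define n where "n = real (Suc (Suc (Suc j)))"
  have n: "n > 0" "16 / (1 - c\<^sup>2 / (4 * \<theta>1)) \<le> n" using j by (auto simp: n_def)
  define p where "p = sqrt ((\<theta> - \<theta>1) / (4 * n))"
  have p: "0 < p" using th n by (simp add: p_def)
  have "p\<^sup>2 = (\<theta> - \<theta>1) / (4 * n)" using th n by (simp add: p_def)
  then have p2: "4 * n * p\<^sup>2 \<le> \<theta> - \<theta>1" using n by (simp add: field_simps)
  \<comment> \<open>Integrating \<open>G'/G = n * (1 - p * y)\<^sup>2 / y\<close> gives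
    \<open>G = y ^ n * e y\<close>, where \<open>e\<close> collects the part without logarithm.
    Below, \<open>h\<close> is the resulting \<open>G'\<close> with its two power factors truncated
    at zero, so that one formula covers the whole line.\<close>
  define e where "e = (\<lambda>y. exp (n * (p\<^sup>2 * y\<^sup>2 / 2 - 2 * p * y)))"
  define e' where "e' = (\<lambda>y. n * (p\<^sup>2 * y - 2 * p) * e y)"
  have e: "(e has_real_derivative e' y) (at y)" for y
    unfolding e_def e'_def by (auto intro!: derivative_eq_intros simp: algebra_simps)
  define U where "U = (\<lambda>y. (max 0 (1 - p * y))\<^sup>2)"
  define U' where "U' = (\<lambda>y. - 2 * p * max 0 (1 - p * y))"
  have U: "(U has_real_derivative U' y) (at y)" for y
  proof -
    have "((\<lambda>y. 1 - p * y) has_real_derivative - p) (at y)"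
      by (auto intro!: derivative_eq_intros)
    from DERIV_chain2[OF DERIV_max_0_power[of 1] this] show ?thesis
      by (simp add: U_def U'_def power2_eq_square algebra_simps)
  qed
  define V where "V = (\<lambda>y. (max 0 y) ^ Suc (Suc j) :: real)"
  define V' where "V' = (\<lambda>y. real (Suc (Suc j)) * (max 0 y) ^ Suc j)"
  have V: "(V has_real_derivative V' y) (at y)" for y
    unfolding V_def V'_def by (rule DERIV_max_0_power) simp
  define h where "h = (\<lambda>y. n * (V y * U y * e y))"
  define h' where "h' = (\<lambda>y. n * (V' y * U y * e y + V y * U' y * e y + V y * U y * e' y))"
  have h: "(h has_real_derivative h' y) (at y)" for y
    unfolding h_def h'_def by (auto intro!: derivative_eq_intros V U e simp: algebra_simps)
  have econt: "continuous_on S e" for S unfolding e_def by (intro continuous_intros) auto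
  have h'cont: "continuous_on S h'" for S
    unfolding h'_def V_def V'_def U_def U'_def e'_def by (intro continuous_intros econt)
  have hcont: "continuous_on S h" for S
    by (meson DERIV_continuous_on h has_field_derivative_at_within)
  have h0: "h y = 0" "h' y = 0" if "y \<le> 0 \<or> 1 / p \<le> y" for y
    using that p by (auto simp: h_def h'_def V_def V'_def U_def U'_def max_def field_simps)
  have hnn: "h y \<ge> 0" for y using n by (simp add: h_def V_def U_def e_def)
  define G where "G = (\<lambda>y. y ^ Suc (Suc (Suc j)) * e y)"
  have G: "(G has_real_derivative h y) (at y)" if y: "0 \<le> y" "y \<le> 1 / p" for y
  proof -
    have "(G has_real_derivative n * y ^ Suc (Suc j) * e y + y ^ Suc (Suc (Suc j)) * e' y) (at y)"
      unfolding G_def by (auto intro!: derivative_eq_intros e simp: n_def simp del: power_Suc)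
    moreover have "max 0 (1 - p * y) = 1 - p * y" "max 0 y = y"
      using y p by (auto simp: max_def field_simps)
    then have "h y = n * y ^ Suc (Suc j) * e y + y ^ Suc (Suc (Suc j)) * e' y"
      by (simp add: h_def V_def U_def e'_def power2_eq_square algebra_simps)
    ultimately show ?thesis by simp
  qed
  have main: "0 \<le> h' y - c * h y + \<theta> * G y" if y: "0 < y" "y \<le> 1 / p" for y
  proof -
    define u where "u = 1 - p * y"
    have u: "0 \<le> u" "u \<le> 1" using y p by (auto simp: u_def field_simps)
    have m: "max 0 (1 - p * y) = u" "max 0 y = y"
      using y u by (auto simp: max_def u_def)
    have nk: "real (Suc (Suc j)) = n - 1" by (simp add: n_def)
    have py: "p * y = 1 - u" by (simp add: u_def)
    have 1: "h' y - c * h y + \<theta> * G y = e y * y ^ Suc j *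
      (n * (n - 1) * u\<^sup>2 - 2 * n * (p * y) * u + n\<^sup>2 * u\<^sup>2 * ((p * y)\<^sup>2 - 2 * (p * y)) - c * n * y * u\<^sup>2 + \<theta> * y\<^sup>2)"
      unfolding h_def h'_def G_def V_def V'_def U_def U'_def e'_def m nk
      by (simp add: power2_eq_square algebra_simps)
    have 2: "n * (n - 1) * u\<^sup>2 - 2 * n * (p * y) * u + n\<^sup>2 * u\<^sup>2 * ((p * y)\<^sup>2 - 2 * (p * y))
      - c * n * y * u\<^sup>2 + \<theta> * y\<^sup>2 = n\<^sup>2 * u ^ 4 + n * u\<^sup>2 - 2 * n * u - c * n * y * u\<^sup>2 + \<theta> * y\<^sup>2"
      unfolding py by (simp add: power2_eq_square power4_eq_xxxx algebra_simps)
    have "0 \<le> n\<^sup>2 * u ^ 4 + n * u\<^sup>2 - 2 * n * u - c * n * y * u\<^sup>2 + \<theta> * y\<^sup>2"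
      by (rule hump_inequality[of \<theta>1 \<theta> c n p]) (use th c n p p2 u py in auto)
    then show ?thesis
      unfolding 1 2 by (intro mult_nonneg_nonneg) (use y in \<open>auto simp: e_def\<close>)
  qed
  define R where "R = exp (1 / p)"
  have R: "R > 1" using p by (simp add: R_def)
  \<comment> \<open>On \<open>{1..R}\<close> this is the derivative of \<open>G (ln x)\<close>; the
    range \<open>{0..1/p}\<close> of \<open>y\<close> becomes \<open>{1..R}\<close> for
    \<open>x\<close>.\<close>
  define \<psi> where "\<psi> = (\<lambda>x. if x > 0 then h (ln x) / x else 0)"
  define \<psi>' where "\<psi>' = (\<lambda>x. if x > 0 then (h' (ln x) - h (ln x)) / x\<^sup>2 else 0)"
  have psi1: "\<psi> x = 0" "\<psi>' x = 0" if "x \<le> 1" for x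
    using that h0[of "ln x"] by (auto simp: \<psi>_def \<psi>'_def)
  have psiR: "\<psi> x = 0" "\<psi>' x = 0" if "R \<le> x" for x
  proof -
    have "x > 0" using that R by linarith
    then have "1 / p \<le> ln x" using that by (simp add: R_def ln_ge_iff)
    with \<open>x > 0\<close> show "\<psi> x = 0" "\<psi>' x = 0" using h0[of "ln x"] by (auto simp: \<psi>_def \<psi>'_def)
  qed
  have psi_deriv: "(\<psi> has_real_derivative \<psi>' x) (at x)" for x
  proof (cases "x > 0")
    case True
    have "((\<lambda>x. h (ln x) / x) has_real_derivative \<psi>' x) (at x)"
      using True by (auto intro!: derivative_eq_intros DERIV_chain2[OF h]
          simp: \<psi>'_def field_simps power2_eq_square)
    then show ?thesis
      by (rule has_field_derivative_transform_within_open[where S = "{0<..}"])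
        (use True in \<open>auto simp: \<psi>_def\<close>)
  next
    case False
    have "((\<lambda>_. 0) has_real_derivative \<psi>' x) (at x)" using False by (simp add: psi1)
    then show ?thesis
      by (rule has_field_derivative_transform_within_open[where S = "{..<1}"])
        (use False psi1 in auto)
  qed
  have psi_cont: "continuous_on S \<psi>" for S
    by (meson DERIV_continuous_on psi_deriv has_field_derivative_at_within)
  have psi'_cont: "continuous_on UNIV \<psi>'"
  proof -
    have "continuous_on {0<..} \<psi>'"
      by (rule continuous_on_eq[of _ "\<lambda>x. (h' (ln x) - h (ln x)) / x\<^sup>2"])
        (auto intro!: continuous_intros continuous_on_compose2[OF h'cont[of UNIV]]
          continuous_on_compose2[OF hcont[of UNIV]] simp: \<psi>'_def)
    moreover have "continuous_on {..<1} \<psi>'"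
      by (rule continuous_on_eq[of _ "\<lambda>_. 0"]) (auto simp: psi1)
    ultimately have "continuous_on ({0<..} \<union> {..<1}) \<psi>'"
      by (intro continuous_on_open_Un) auto
    moreover have "{0<..} \<union> {..<1::real} = UNIV" by auto
    ultimately show ?thesis by simp
  qed
  have int_psi: "\<psi> integrable_on {x..y}" for x y
    by (intro integrable_continuous_interval psi_cont)
  have int1: "(LBINT z:{0<..<x}. \<psi> z) = 0" if "x \<le> 1" for x
  proof -
    have "integral {0..x} \<psi> = integral {0..x} (\<lambda>_. 0)"
      by (rule integral_cong) (use that psi1 in auto)
    then show ?thesis by (simp add: set_integral_open_interval psi_cont)
  qed
  have int2: "(LBINT z:{0<..<x}. \<psi> z) = G (ln x)" if x: "1 \<le> x" "x \<le> R" for x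
  proof -
    have "integral {0..x} \<psi> = integral {0..1} \<psi> + integral {1..x} \<psi>"
      by (subst Henstock_Kurzweil_Integration.integral_combine) (use int_psi x in auto)
    also have "integral {0..1} \<psi> = 0"
      using int1[of 1] by (simp add: set_integral_open_interval psi_cont)
    also have "integral {1..x} \<psi> = G (ln x) - G (ln 1)"
    proof (rule integral_unique, rule fundamental_theorem_of_calculus)
      fix z assume z: "z \<in> {1..x}"
      have "ln z \<le> 1 / p" using z x ln_le_cancel_iff[of z R] R by (auto simp: R_def)
      then have "((\<lambda>z. G (ln z)) has_real_derivative \<psi> z) (at z)"
        using DERIV_chain2[OF G[of "ln z"] DERIV_ln[of z]] z by (simp add: \<psi>_def divide_inverse)
      then show "((\<lambda>z. G (ln z)) has_vector_derivative \<psi> z) (at z within {1..x})"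
        using has_field_derivative_at_within has_real_derivative_iff_has_vector_derivative by blast
    qed (use x in auto)
    finally show ?thesis by (simp add: set_integral_open_interval psi_cont G_def)
  qed
  define m where "m = G (1 / p)"
  have int3: "(LBINT z:{0<..<x}. \<psi> z) = m" if x: "R \<le> x" for x
  proof -
    have "integral {0..x} \<psi> = integral {0..R} \<psi> + integral {R..x} \<psi>"
      by (subst Henstock_Kurzweil_Integration.integral_combine) (use int_psi x R in auto)
    also have "integral {R..x} \<psi> = integral {R..x} (\<lambda>_. 0)"
      by (rule integral_cong) (use psiR in auto)
    also have "integral {0..R} \<psi> = m"
      using int2[of R] R by (simp add: set_integral_open_interval psi_cont m_def R_def)
    finally show ?thesis by (simp add: set_integral_open_interval psi_cont)
  qed
  have m: "m > 0" using p by (simp add: m_def G_def e_def)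
  show thesis
  proof (rule that[OF R \<mu> m psi_deriv psi'_cont _ _ int3])
    show "0 \<le> \<psi> x" for x using hnn by (simp add: \<psi>_def)
    show "\<psi> x = 0" if "x \<notin> {1..R}" for x
      using that psi1 psiR by force
    show "\<mu> * \<psi> x \<le> x * \<psi>' x - \<psi> x + \<theta> / x * (LBINT z:{0<..<x}. \<psi> z)" if x: "0 < x" for x
    proof -
      \<comment> \<open>Up to \<open>1\<close> both sides vanish, on \<open>{1<..R}\<close> the
        claim is \<open>main\<close> divided by \<open>x\<close>, and beyond \<open>R\<close> only
        the positive term \<open>\<theta> * m / x\<close> survives.\<close>
      consider "x \<le> 1" | "1 < x" "x \<le> R" | "R < x" by linarith
      then show ?thesis
      proof cases
        case 1 then show ?thesis by (simp add: psi1 int1)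
      next
        case 2
        have "ln x \<le> 1 / p" using 2 ln_le_cancel_iff[of x R] R by (auto simp: R_def)
        then have "0 \<le> (h' (ln x) - c * h (ln x) + \<theta> * G (ln x)) / x"
          using main[of "ln x"] 2 by simp
        also have "\<dots> = x * \<psi>' x - \<psi> x + \<theta> / x * G (ln x) - \<mu> * \<psi> x"
          using x by (simp add: \<psi>_def \<psi>'_def c_def field_simps power2_eq_square)
        finally show ?thesis using 2 by (simp add: int2)
      next
        case 3 then show ?thesis using psiR[of x] int3[of x] m R assms by simp
      qed
    qed
  qed
qed

section \<open>Integrals against measures with a finite moment\<close>

lemma space_eq_half_line: "sets \<mu> = sets half_line \<Longrightarrow> space \<mu> = {0<..}"
  by (drule sets_eq_imp_space_eq) (simp add: half_line_def space_restrict_space)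

lemma borel_measurable_half_line:
  fixes f :: "real \<Rightarrow> real"
  assumes "sets \<mu> = sets half_line" "continuous_on {0<..} f"
  shows "f \<in> borel_measurable \<mu>"
proof -
  have "f \<in> borel_measurable half_line"
    unfolding half_line_def by (rule borel_measurable_continuous_on_restrict) (rule assms)
  then show ?thesis using assms(1) measurable_cong_sets by blast
qed

lemma integrable_moment_space:
  fixes f :: "real \<Rightarrow> real"
  assumes "\<mu> \<in> moment_space s" "continuous_on {0<..} f" "\<And>x. 0 < x \<Longrightarrow> \<bar>f x\<bar> \<le> C * x powr s"
  shows "integrable \<mu> f"
proof -
  have sets: "sets \<mu> = sets half_line" and fin: "(\<integral>\<^sup>+ x. ennreal (x powr s) \<partial>\<mu>) < \<infinity>"
    using assms(1) by (auto simp: moment_space_def)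
  have "integrable \<mu> (\<lambda>x. x powr s)"
    by (rule integrableI_nonneg)
      (use fin in \<open>auto intro!: borel_measurable_half_line[OF sets] continuous_intros\<close>)
  then have "integrable \<mu> (\<lambda>x. C * x powr s)" by simp
  then show ?thesis
    by (rule Bochner_Integration.integrable_bound[OF _ borel_measurable_half_line[OF sets assms(2)]])
      (use assms(3) space_eq_half_line[OF sets] in
        \<open>auto intro!: AE_I2 order_trans[OF assms(3)] abs_ge_self\<close>)
qed

text \<open>The quotient of \<open>f\<close> by \<open>x powr s\<close> is bounded and continuous,
  hence an admissible \<open>\<psi>\<close> in the definition of
  \<open>moment_continuous_on\<close>.\<close>

lemma continuous_on_integral_C_moment:
  fixes f :: "real \<Rightarrow> real"
  assumes "u \<in> C_moment I s" "continuous_on {0<..} f" "\<And>x. 0 < x \<Longrightarrow> \<bar>f x\<bar> \<le> C * x powr s"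
  shows "continuous_on I (\<lambda>t. \<integral>x. f x \<partial>(u t))"
proof -
  define g where "g x = f x * x powr (- s)" for x
  have "continuous_on {0<..} g" unfolding g_def
    by (intro continuous_intros assms(2)) auto
  moreover have "bounded (g ` {0<..})"
    unfolding bounded_iff
  proof (intro exI[of _ C] ballI)
    fix y assume "y \<in> g ` {0<..}"
    then obtain x where x: "x > 0" "y = g x" by auto
    have "\<bar>f x\<bar> * x powr (- s) \<le> C * x powr s * x powr (- s)"
      by (intro mult_right_mono assms(3)) (use x in auto)
    also have "\<dots> = C" using x by (simp add: powr_minus)
    finally show "norm y \<le> C" using x by (simp add: g_def abs_mult)
  qed
  ultimately have "continuous_on I (\<lambda>t. \<integral>x. x powr s * g x \<partial>(u t))"
    using assms(1) by (auto simp: C_moment_def moment_continuous_on_def)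
  moreover have "(\<integral>x. x powr s * g x \<partial>(u t)) = (\<integral>x. f x \<partial>(u t))" if "t \<in> I" for t
  proof (rule Bochner_Integration.integral_cong[OF refl])
    fix x assume x: "x \<in> space (u t)"
    have "sets (u t) = sets half_line"
      using assms(1) that by (auto simp: C_moment_def moment_space_def)
    then have "x > 0" using space_eq_half_line x by auto
    then show "x powr s * g x = f x" by (simp add: g_def powr_minus)
  qed
  ultimately show ?thesis by (simp cong: continuous_on_cong)
qed

text \<open>On the compact middle range the quotient by \<open>x powr s\<close> is bounded by
  continuity. This supplies the domination hypotheses of the two preceding integral lemmas for
  functions that vanish near \<open>0\<close>.\<close>

lemma powr_dominated:
  fixes g :: "real \<Rightarrow> real"
  assumes g: "continuous_on {0<..} g" and "0 < a" and zero: "\<And>x. 0 < x \<Longrightarrow> x < a \<Longrightarrow> g x = 0"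
    and large: "\<And>x. b < x \<Longrightarrow> \<bar>g x\<bar> \<le> K * x powr s"
  obtains C where "0 \<le> C" "\<And>x. 0 < x \<Longrightarrow> \<bar>g x\<bar> \<le> C * x powr s"
proof -
  have "compact ((\<lambda>x. g x * x powr (- s)) ` {a..b})"
    by (intro compact_continuous_image continuous_intros continuous_on_subset[OF g])
      (use \<open>0 < a\<close> in auto)
  then obtain K' where K': "\<And>x. x \<in> {a..b} \<Longrightarrow> \<bar>g x * x powr (- s)\<bar> \<le> K'"
    using compact_imp_bounded by (fastforce simp: bounded_iff)
  have *: "\<bar>g x\<bar> \<le> K' * x powr s" if "x \<in> {a..b}" for x
  proof -
    have "x > 0" using that \<open>0 < a\<close> by auto
    then have "\<bar>g x\<bar> = \<bar>g x * x powr (- s)\<bar> * x powr s" by (simp add: abs_mult powr_minus)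
    also have "\<dots> \<le> K' * x powr s" by (intro mult_right_mono K' that) auto
    finally show ?thesis .
  qed
  show thesis
  proof (rule that[of "max 0 (max K K')"])
    fix x :: real assume x: "0 < x"
    consider "x < a" | "x \<in> {a..b}" | "b < x" by force
    then show "\<bar>g x\<bar> \<le> max 0 (max K K') * x powr s"
    proof cases
      case 1 then show ?thesis using zero x by simp
    next
      case 2 show ?thesis
        by (rule order_trans[OF *[OF 2]]) (intro mult_right_mono, auto)
    next
      case 3 show ?thesis
        by (rule order_trans[OF large[OF 3]]) (intro mult_right_mono, auto)
    qed
  qed auto
qed

section \<open>From the weak formulation to an equation for moments\<close>

lemma set_integrable_Int_support:
  fixes F :: "real \<Rightarrow> real"
  assumes "\<And>s. s \<notin> K \<Longrightarrow> F s = 0"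
  shows "set_integrable M S F \<longleftrightarrow> set_integrable M (S \<inter> K) F"
  unfolding set_integrable_def
  by (rule Bochner_Integration.integrable_cong) (use assms in \<open>auto simp: indicator_def\<close>)

lemma continuous_on_primitive:
  fixes f :: "real \<Rightarrow> real"
  assumes f: "continuous_on UNIV f"
  shows "continuous_on {0<..} (\<lambda>x. LBINT z:{0<..<x}. f z)"
proof (rule continuous_at_imp_continuous_on, intro ballI)
  fix x :: real assume "x \<in> {0<..}"
  then have x: "x > 0" by simp
  have fc: "continuous_on S f" for S using f continuous_on_subset by blast
  have "continuous_on {0..x+1} (\<lambda>x. integral {0..x} f)"
    by (intro indefinite_integral_continuous_1 integrable_continuous_interval fc)
  then have "continuous_on {0..x+1} (\<lambda>x. LBINT z:{0<..<x}. f z)"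
    by (simp add: set_integral_open_interval[OF fc])
  moreover have "x \<in> interior {0..x+1}" using x by simp
  ultimately show "isCont (\<lambda>x. LBINT z:{0<..<x}. f z) x"
    using continuous_on_interior by blast
qed

text \<open>Separated variables reduce the weak formulation to one in time alone, with
  \<open>h\<close> as test function. The support is a closed subset of the rectangle
  \<open>{a..b} \<times> {c..d}\<close>, hence compact.\<close>

lemma product_in_test_functions:
  fixes h \<psi> :: "real \<Rightarrow> real"
  assumes h: "\<And>t. (h has_real_derivative h' t) (at t)" "continuous_on UNIV h'"
    and psi: "\<And>x. (\<psi> has_real_derivative \<psi>' x) (at x)" "continuous_on UNIV \<psi>'"
    and supp: "\<And>t. t \<notin> {a..b} \<Longrightarrow> h t = 0" "\<And>x. x \<notin> {c..d} \<Longrightarrow> \<psi> x = 0"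
    and "t0 < a" "b < t1" "0 < c"
  shows "(\<lambda>t x. h t * \<psi> x) \<in> test_functions t0 t1"
proof -
  have hc: "continuous_on UNIV h" "continuous_on UNIV \<psi>"
    by (meson DERIV_continuous_on h psi has_field_derivative_at_within)+
  have D1: "((\<lambda>s. h s * \<psi> x) has_real_derivative h' t * \<psi> x) (at t)" for t x
    by (auto intro!: derivative_eq_intros h)
  have D2: "((\<lambda>y. h t * \<psi> y) has_real_derivative h t * \<psi>' x) (at x)" for t x
    by (auto intro!: derivative_eq_intros psi)
  have cl: "closure {(t, x). h t * \<psi> x \<noteq> 0} \<subseteq> {a..b} \<times> {c..d}"
  proof (rule closure_minimal)
    show "{(t, x). h t * \<psi> x \<noteq> 0} \<subseteq> {a..b} \<times> {c..d}"
      using supp by (auto simp del: atLeastAtMost_iff)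
  qed (auto intro: closed_Times)
  have "compact ({a..b} \<times> {c..d})" by (intro compact_Times) auto
  then have "compact ({a..b} \<times> {c..d} \<inter> closure {(t, x). h t * \<psi> x \<noteq> 0})"
    by (rule compact_Int_closed) simp
  with cl have comp: "compact (closure {(t, x). h t * \<psi> x \<noteq> 0})"
    by (simp add: inf.absorb2)
  have cont1: "continuous_on UNIV (\<lambda>(t, x). h' t * \<psi> x)"
    unfolding case_prod_unfold
    by (intro continuous_intros continuous_on_compose2[OF h(2)] continuous_on_compose2[OF hc(2)]) auto
  have cont2: "continuous_on UNIV (\<lambda>(t, x). h t * \<psi>' x)"
    unfolding case_prod_unfold
    by (intro continuous_intros continuous_on_compose2[OF psi(2)] continuous_on_compose2[OF hc(1)]) auto
  have "(\<lambda>s. h s * \<psi> x) differentiable (at t)" "(\<lambda>y. h t * \<psi> y) differentiable (at x)" for t x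
    using D1 D2 real_differentiable_def by blast+
  moreover have "continuous_on UNIV (\<lambda>(t, x). deriv (\<lambda>s. h s * \<psi> x) t)"
    using cont1 unfolding DERIV_imp_deriv[OF D1] .
  moreover have "continuous_on UNIV (\<lambda>(t, x). deriv (\<lambda>y. h t * \<psi> y) x)"
    using cont2 unfolding DERIV_imp_deriv[OF D2] .
  moreover have "closure {(t, x). h t * \<psi> x \<noteq> 0} \<subseteq> {t0<..<t1} \<times> {0<..}"
    by (rule order_trans[OF cl]) (use assms in auto)
  ultimately show ?thesis
    using comp unfolding test_functions_def by blast
qed

text \<open>Testing with \<open>h t * \<psi> x\<close> identifies the weak time derivative of the
  integral of \<open>\<psi>\<close>; continuity in time upgrades it to a true derivative. All
  integrands vanish near \<open>0\<close>, so one moment controls them. The nonlocal one is a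
  constant times \<open>x powr (\<gamma> - 1)\<close> at infinity, whence the condition
  \<open>\<gamma> - 1 \<le> s\<close>.\<close>

lemma weak_solution_moment_derivative:
  fixes \<psi> \<psi>' :: "real \<Rightarrow> real"
  assumes sol: "nonneg_weak_solution \<gamma> \<theta> 0 T v" and v: "v \<in> C_moment {0..<T} s" and s: "\<gamma> - 1 \<le> s"
    and psi: "\<And>x. (\<psi> has_real_derivative \<psi>' x) (at x)" "continuous_on UNIV \<psi>'"
    and supp: "\<And>x. x \<notin> {c..d} \<Longrightarrow> \<psi> x = 0" and "0 < c"
    and t: "t \<in> {0<..<T}"
  defines "L \<equiv> \<lambda>x. x powr (\<gamma> + 1) * \<psi>' x - x powr \<gamma> * \<psi> x
      + \<theta> * (x powr (\<gamma> - 1) * (LBINT z:{0<..<x}. \<psi> z))"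
  shows "((\<lambda>t. \<integral>x. \<psi> x \<partial>(v t)) has_real_derivative (\<integral>x. L x \<partial>(v t))) (at t)"
    and "integrable (v t) \<psi>" and "integrable (v t) L"
proof -
  define L1 where "L1 = (\<lambda>x. x powr (\<gamma> + 1) * \<psi>' x - x powr \<gamma> * \<psi> x)"
  define L2 where "L2 = (\<lambda>x. x powr (\<gamma> - 1) * (LBINT z:{0<..<x}. \<psi> z))"
  have psic: "continuous_on S \<psi>" for S
    by (meson DERIV_continuous_on psi has_field_derivative_at_within)
  have psi'c: "continuous_on S \<psi>'" for S using psi(2) continuous_on_subset by blast
  have supp': "\<psi>' x = 0" if "x \<notin> {c..d}" for x
  proof -
    have "((\<lambda>_. 0) has_real_derivative \<psi>' x) (at x)"
      by (rule has_field_derivative_transform_within_open[OF psi(1), where S = "- {c..d}"])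
        (use that supp in \<open>auto intro: open_Compl\<close>)
    then show ?thesis using DERIV_unique DERIV_const by blast
  qed
  have prim0: "(LBINT z:{0<..<x}. \<psi> z) = 0" if "x < c" for x
  proof -
    have "(LBINT z:{0<..<x}. \<psi> z) = (LBINT z:{0<..<x}. 0)"
      by (rule set_lebesgue_integral_cong) (use that supp in auto)
    then show ?thesis by simp
  qed
  \<comment> \<open>The maximum with \<open>1\<close> ensures \<open>x > 1\<close> beyond
    \<open>d'\<close>, where \<open>x powr\<close> is monotone in the exponent.\<close>
  define d' where "d' = max 1 d"
  have prim1: "(LBINT z:{0<..<x}. \<psi> z) = (LBINT z:{0<..<d'}. \<psi> z)" if "d' < x" for x
  proof -
    have "integral {0..x} \<psi> = integral {0..d'} \<psi> + integral {d'..x} \<psi>"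
      by (subst Henstock_Kurzweil_Integration.integral_combine)
        (use that in \<open>auto simp: d'_def intro!: integrable_continuous_interval psic\<close>)
    \<comment> \<open>If \<open>d' = d\<close>, then \<open>supp\<close> does not give the value at
      this endpoint, so it is discarded as a null set.\<close>
    also have "integral {d'..x} \<psi> = integral {d'..x} (\<lambda>_. 0)"
      by (rule integral_spike[of "{d'}"]) (auto intro!: supp simp: d'_def max_def split: if_splits)
    finally show ?thesis by (simp add: set_integral_open_interval psic)
  qed
  have L1c: "continuous_on {0<..} L1" unfolding L1_def by (intro continuous_intros psic psi'c) auto
  have L2c: "continuous_on {0<..} L2" unfolding L2_def
    by (intro continuous_intros continuous_on_primitive psic) auto
  obtain C0 where C0: "\<And>x. 0 < x \<Longrightarrow> \<bar>\<psi> x\<bar> \<le> C0 * x powr s"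
    by (rule powr_dominated[of \<psi> c d 0 s]) (use supp \<open>0 < c\<close> psic in auto)
  obtain C1 where C1: "\<And>x. 0 < x \<Longrightarrow> \<bar>L1 x\<bar> \<le> C1 * x powr s"
    by (rule powr_dominated[OF L1c \<open>0 < c\<close>, of d 0 s]) (use supp supp' in \<open>auto simp: L1_def\<close>)
  obtain C2 where C2: "\<And>x. 0 < x \<Longrightarrow> \<bar>L2 x\<bar> \<le> C2 * x powr s"
  proof (rule powr_dominated[OF L2c \<open>0 < c\<close>, of d' "\<bar>LBINT z:{0<..<d'}. \<psi> z\<bar>" s])
    show "L2 x = 0" if "x < c" for x using that prim0 by (simp add: L2_def)
    show "\<bar>L2 x\<bar> \<le> \<bar>LBINT z:{0<..<d'}. \<psi> z\<bar> * x powr s" if "d' < x" for x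
    proof -
      have "x powr (\<gamma> - 1) \<le> x powr s" using that s by (intro powr_mono) (auto simp: d'_def)
      then show ?thesis unfolding L2_def prim1[OF that]
        by (simp add: abs_mult mult.commute mult_right_mono)
    qed
  qed (rule that)
  define A B1 B2 where "A = (\<lambda>t. \<integral>x. \<psi> x \<partial>(v t))" and "B1 = (\<lambda>t. \<integral>x. L1 x \<partial>(v t))"
    and "B2 = (\<lambda>t. \<integral>x. L2 x \<partial>(v t))"
  have vt: "v t \<in> moment_space s" if "t \<in> {0<..<T}" for t
    using v that by (auto simp: C_moment_def)
  have int0: "integrable (v t) \<psi>" if "t \<in> {0<..<T}" for t
    by (rule integrable_moment_space[OF vt[OF that] psic C0])
  have int1: "integrable (v t) L1" if "t \<in> {0<..<T}" for t
    by (rule integrable_moment_space[OF vt[OF that] L1c C1])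
  have int2: "integrable (v t) L2" if "t \<in> {0<..<T}" for t
    by (rule integrable_moment_space[OF vt[OF that] L2c C2])
  have sub: "{0<..<T} \<subseteq> {0..<T}" by auto
  have Ac: "continuous_on {0<..<T} A" unfolding A_def
    by (rule continuous_on_subset[OF continuous_on_integral_C_moment[OF v psic C0] sub])
  have B1c: "continuous_on {0<..<T} B1" unfolding B1_def
    by (rule continuous_on_subset[OF continuous_on_integral_C_moment[OF v L1c C1] sub])
  have B2c: "continuous_on {0<..<T} B2" unfolding B2_def
    by (rule continuous_on_subset[OF continuous_on_integral_C_moment[OF v L2c C2] sub])
  have L_eq: "L = (\<lambda>x. L1 x + \<theta> * L2 x)" by (auto simp: L_def L1_def L2_def)
  have B_eq: "(\<integral>x. L x \<partial>(v t)) = B1 t + \<theta> * B2 t" if "t \<in> {0<..<T}" for t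
    unfolding L_eq B1_def B2_def using int1[OF that] int2[OF that] by simp
  show "integrable (v t) \<psi>" by (rule int0[OF t])
  show "integrable (v t) L" unfolding L_eq using int1[OF t] int2[OF t] by simp
  have "(A has_real_derivative B1 t + \<theta> * B2 t) (at t)"
  proof (rule weak_derivative_imp_DERIV[OF Ac _ _ t])
    show "continuous_on {0<..<T} (\<lambda>t. B1 t + \<theta> * B2 t)" by (intro continuous_intros B1c B2c)
    fix h h' :: "real \<Rightarrow> real" and a b
    assume ab: "0 < a" "a < b" "b < T" and h: "\<forall>t. (h has_real_derivative h' t) (at t)"
      and h': "continuous_on UNIV h'" and h0: "\<forall>t. t \<notin> {a..b} \<longrightarrow> h t = 0"
    have hc: "continuous_on S h" for S
      using h by (meson DERIV_continuous_on has_field_derivative_at_within)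
    have h'c: "continuous_on S h'" for S using h' continuous_on_subset by blast
    have h'0: "h' t = 0" if "t \<notin> {a..b}" for t
    proof -
      have "((\<lambda>_. 0) has_real_derivative h' t) (at t)"
        by (rule has_field_derivative_transform_within_open[of h _ _ "- {a..b}"])
          (use that h h0 in \<open>auto intro: open_Compl\<close>)
      then show ?thesis using DERIV_unique DERIV_const by blast
    qed
    have absub: "{a..b} \<subseteq> {0<..<T}" using ab by auto
    have sint: "set_integrable lborel {0<..<T} F"
      if "continuous_on {a..b} F" "\<And>s. s \<notin> {a..b} \<Longrightarrow> F s = 0" for F :: "real \<Rightarrow> real"
    proof -
      have "set_integrable lborel ({0<..<T} \<inter> {a..b}) F"
        using borel_integrable_atLeastAtMost'[OF that(1)] by (simp only: Int_absorb1[OF absub])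
      then show ?thesis by (subst set_integrable_Int_support[OF that(2)])
    qed
    have i0: "set_integrable lborel {0<..<T} (\<lambda>t. h' t * A t)"
      by (rule sint) (auto intro!: continuous_intros h'c continuous_on_subset[OF Ac absub] simp: h'0)
    have i1: "set_integrable lborel {0<..<T} (\<lambda>t. h t * B1 t)"
      by (rule sint) (use h0 in \<open>auto intro!: continuous_intros hc continuous_on_subset[OF B1c absub]\<close>)
    have i2: "set_integrable lborel {0<..<T} (\<lambda>t. h t * B2 t)"
      by (rule sint) (use h0 in \<open>auto intro!: continuous_intros hc continuous_on_subset[OF B2c absub]\<close>)
    \<comment> \<open>For this product the transport term is
      \<open>h' t * \<psi> x + h t * L1 x\<close> and the fragmentation term is
      \<open>h t * L2 y\<close>. The weak formulation thus becomes an identity between time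
      integrals of \<open>A\<close>, \<open>B1\<close> and \<open>B2\<close>.\<close>
    define \<phi> where "\<phi> = (\<lambda>t x. h t * \<psi> x)"
    have "\<phi> \<in> test_functions 0 T" unfolding \<phi>_def
      by (rule product_in_test_functions[of h h' \<psi> \<psi>' a b c d])
        (use h h' psi h0 supp ab \<open>0 < c\<close> in auto)
    then have weak: "(LBINT t:{0<..<T}. \<integral>x. transport_term \<gamma> \<phi> t x \<partial>(v t)) =
          - \<theta> * (LBINT t:{0<..<T}. \<integral>y. fragmentation_term \<gamma> \<phi> t y \<partial>(v t))"
      using sol by (auto simp: nonneg_weak_solution_def)
    have tr: "transport_term \<gamma> \<phi> t x = h' t * \<psi> x + h t * L1 x" for t x
    proof -
      have "deriv (\<lambda>s. h s * \<psi> x) t = h' t * \<psi> x"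
        by (rule DERIV_imp_deriv) (use h in \<open>auto intro!: derivative_eq_intros\<close>)
      moreover have "deriv (\<lambda>y. h t * \<psi> y) x = h t * \<psi>' x"
        by (rule DERIV_imp_deriv) (use psi in \<open>auto intro!: derivative_eq_intros\<close>)
      ultimately show ?thesis by (simp add: transport_term_def \<phi>_def L1_def algebra_simps)
    qed
    have fr: "fragmentation_term \<gamma> \<phi> t y = h t * L2 y" for t y
      by (simp add: fragmentation_term_def \<phi>_def L2_def)
    have "(LBINT t:{0<..<T}. \<integral>x. transport_term \<gamma> \<phi> t x \<partial>(v t)) =
        (LBINT t:{0<..<T}. h' t * A t + h t * B1 t)"
      by (rule set_lebesgue_integral_cong) (auto simp: tr A_def B1_def int0 int1)
    also have "\<dots> = (LBINT t:{0<..<T}. h' t * A t) + (LBINT t:{0<..<T}. h t * B1 t)"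
      by (rule set_integral_add(2)[OF i0 i1])
    finally have e1: "(LBINT t:{0<..<T}. h' t * A t) + (LBINT t:{0<..<T}. h t * B1 t) =
      - \<theta> * (LBINT t:{0<..<T}. h t * B2 t)"
      using weak by (simp add: fr B2_def)
    have "(LBINT t:{0<..<T}. h t * (B1 t + \<theta> * B2 t)) =
        (LBINT t:{0<..<T}. h t * B1 t + \<theta> * (h t * B2 t))"
      by (simp add: algebra_simps)
    also have "\<dots> = (LBINT t:{0<..<T}. h t * B1 t) + \<theta> * (LBINT t:{0<..<T}. h t * B2 t)"
      using set_integral_add(2)[OF i1 set_integrable_mult_right[OF i2]] by simp
    finally show "(LBINT t:{0<..<T}. h' t * A t) = - (LBINT t:{0<..<T}. h t * (B1 t + \<theta> * B2 t))"
      using e1 by simp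
  qed
  then show "((\<lambda>t. \<integral>x. \<psi> x \<partial>(v t)) has_real_derivative (\<integral>x. L x \<partial>(v t))) (at t)"
    unfolding B_eq[OF t] A_def .
qed

section \<open>Powers as test functions for the initial condition\<close>

lemma powr_in_E:
  assumes "p - 1 \<le> s" "s \<le> q - 1"
  shows "(\<lambda>x. x powr s) \<in> E p q"
proof -
  \<comment> \<open>The falling factorial, which is the coefficient in the \<open>k\<close>-th
    derivative of \<open>x powr s\<close>. Every seminorm thus reduces to boundedness of
    \<open>weight p q x * x powr (s + 1)\<close>, and the hypotheses give the right signs of the
    exponents \<open>s + 1 - p\<close> up to \<open>1\<close> and \<open>s + 1 - q\<close>
    beyond.\<close>
  define a where "a k = (\<Prod>i<k. s - real i)" for k
  have D: "((\<lambda>x. a k * x powr (s - real k)) has_real_derivative a (Suc k) * x powr (s - real (Suc k))) (at x)"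
    if "x > 0" for k x
    using that by (auto intro!: derivative_eq_intros simp: a_def algebra_simps)
  have eq: "(deriv ^^ k) (\<lambda>x. x powr s) x = a k * x powr (s - real k)" if "x > 0" for k x
    using that
  proof (induction k arbitrary: x)
    case 0 then show ?case by (simp add: a_def)
  next
    case (Suc k)
    have "((deriv ^^ k) (\<lambda>x. x powr s) has_real_derivative a (Suc k) * x powr (s - real (Suc k))) (at x)"
      by (rule has_field_derivative_transform_within_open[OF D, where S = "{0<..}"])
        (use Suc in auto)
    then show ?case by (simp add: DERIV_imp_deriv)
  qed
  have "(deriv ^^ k) (\<lambda>x. x powr s) differentiable_on {0<..}" for k
    unfolding differentiable_on_def
  proof
    fix x :: real assume x: "x \<in> {0<..}"
    have "((deriv ^^ k) (\<lambda>x. x powr s) has_real_derivative a (Suc k) * x powr (s - real (Suc k))) (at x)"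
      by (rule has_field_derivative_transform_within_open[OF D, where S = "{0<..}"])
        (use x eq in auto)
    then show "(deriv ^^ k) (\<lambda>x. x powr s) differentiable at x within {0<..}"
      using differentiable_at_withinI real_differentiable_def by blast
  qed
  moreover have "bdd_above (weighted_deriv p q k (\<lambda>x. x powr s) ` {0<..})" for k
  proof (intro bdd_aboveI2)
    fix x :: real assume "x \<in> {0<..}"
    then have x: "x > 0" by simp
    have "weighted_deriv p q k (\<lambda>x. x powr s) x =
        \<bar>a k\<bar> * (weight p q x * (x powr (real k + 1) * x powr (s - real k)))"
      using x by (simp add: weighted_deriv_def eq abs_mult powr_add powr_realpow algebra_simps)
    also have "x powr (real k + 1) * x powr (s - real k) = x powr (s + 1)"
      by (simp add: add.commute flip: powr_add)
    also have "\<bar>a k\<bar> * (weight p q x * x powr (s + 1)) \<le> \<bar>a k\<bar> * 1"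
    proof (intro mult_left_mono)
      show "weight p q x * x powr (s + 1) \<le> 1"
        using assms x
        by (auto simp: weight_def powr_le1 ge_one_powr_ge_zero powr_le_one_le simp flip: powr_add
            intro: order_trans[OF powr_mono[of _ 0]])
    qed auto
    finally show "weighted_deriv p q k (\<lambda>x. x powr s) x \<le> \<bar>a k\<bar> * 1" .
  qed
  ultimately show ?thesis by (auto simp: E_def)
qed

text \<open>The weak-* topology is a subspace of a product topology, so convergence can be read off
  at the single coordinate \<open>x powr s\<close>, whose value at \<open>1\<close> is
  \<open>1\<close>.\<close>

lemma weak_star_tendsto_moment:
  assumes "weak_star_tendsto p q u dirac_one F" "p - 1 \<le> s" "s \<le> q - 1"
  shows "((\<lambda>t. \<integral>x. x powr s \<partial>(u t)) \<longlongrightarrow> 1) F"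
    and "\<forall>\<^sub>F t in F. integrable (u t) (\<lambda>x. x powr s)"
proof -
  have E: "(\<lambda>x. x powr s) \<in> E p q" by (rule powr_in_E) (use assms in auto)
  then show "\<forall>\<^sub>F t in F. integrable (u t) (\<lambda>x. x powr s)"
    using assms(1) unfolding weak_star_tendsto_def by (auto elim: eventually_mono)
  have "limitin (product_topology (\<lambda>_. euclideanreal) (E p q))
       (\<lambda>t. measure_functional p q (u t)) (measure_functional p q dirac_one) F"
    using assms(1) by (auto simp: weak_star_tendsto_def weak_star_topology_def limitin_subtopology)
  then have "limitin euclideanreal (\<lambda>t. measure_functional p q (u t) (\<lambda>x. x powr s))
      (measure_functional p q dirac_one (\<lambda>x. x powr s)) F"
    using E by (auto simp: limitin_componentwise)
  moreover have "(\<integral>x. x powr s \<partial>dirac_one) = 1"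
    unfolding dirac_one_def
    by (subst integral_return)
      (auto intro!: borel_measurable_half_line continuous_intros simp: space_eq_half_line)
  ultimately show "((\<lambda>t. \<integral>x. x powr s \<partial>(u t)) \<longlongrightarrow> 1) F"
    using E by (simp add: measure_functional_def)
qed

section \<open>Asymptotics, scaling and localisation near \<open>1\<close>\<close>

lemma filterlim_exp_powr_mult_powr:
  fixes \<kappa> \<gamma> s :: real
  assumes "\<kappa> > 0" "\<gamma> < 0"
  shows "filterlim (\<lambda>\<epsilon>. exp (\<kappa> * \<epsilon> powr \<gamma>) * \<epsilon> powr s) at_top (at_right 0)"
  using assms by real_asymp

lemma set_integral_scale:
  fixes f :: "real \<Rightarrow> real"
  assumes "0 < c"
  shows "(LBINT z:{0<..<x}. f (z / c)) = c * (LBINT z:{0<..<x / c}. f z)"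
proof -
  have "(LBINT z:{0<..<x}. f (z / c)) =
      c * (\<integral>z. indicator {0<..<x} (c * z) *\<^sub>R f (c * z / c) \<partial>lborel)"
    unfolding set_lebesgue_integral_def
    using lborel_integral_real_affine[of c "\<lambda>z. indicator {0<..<x} z *\<^sub>R f (z / c)" 0] assms by simp
  also have "(\<lambda>z. indicator {0<..<x} (c * z) *\<^sub>R f (c * z / c)) = (\<lambda>z. indicator {0<..<x / c} z *\<^sub>R f z)"
    using assms by (auto simp: indicator_def field_simps zero_less_mult_iff)
  finally show ?thesis by (simp add: set_lebesgue_integral_def)
qed

text \<open>
  Powers belong to \<^const>\<open>E\<close>, so this combination replaces a cutoff function at \<open>1\<close>:
  it equals \<open>x\<^sup>r (1 - 4 (1 - x\<^bsup>a/2\<^esup>)\<^sup>2)\<close>, and its value at \<open>1\<close> is \<open>1\<close>.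
\<close>

lemma bump_of_powers:
  fixes r a :: real
  assumes "0 < r" "0 < a"
  defines "f \<equiv> \<lambda>x. 8 * x powr (r + a / 2) - 3 * x powr r - 4 * x powr (r + a)"
  obtains k1 k2 where "0 < k1" "0 < k2"
    "\<And>x. 0 < x \<Longrightarrow> 0 < f x \<Longrightarrow> k1 \<le> x \<and> x \<le> k2 \<and> f x \<le> k2 powr r"
proof (rule that[of "(1/2) powr (2 / a)" "(3/2) powr (2 / a)"])
  fix x :: real assume x: "0 < x" "0 < f x"
  \<comment> \<open>In this variable the second factor \<open>1 - 4 * (1 - y)\<^sup>2\<close> is at
    most \<open>1\<close> and positive only for \<open>1/2 < y < 3/2\<close>; the witnesses are the
    corresponding values of \<open>x\<close>.\<close>
  define y where "y = x powr (a / 2)"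
  have y2: "x powr a = y\<^sup>2" using x by (simp add: y_def power2_eq_square flip: powr_add)
  have f: "f x = x powr r * (1 - 4 * (1 - y)\<^sup>2)"
    by (simp add: f_def powr_add y2) (simp add: y_def[symmetric] power2_eq_square algebra_simps)
  have "0 < 1 - 4 * (1 - y)\<^sup>2" using x(2) unfolding f by (simp add: zero_less_mult_iff)
  then have "(1 - y)\<^sup>2 < (1/2)\<^sup>2" by (simp add: power2_eq_square)
  then have "\<bar>1 - y\<bar> < 1/2" by (metis abs_le_square_iff abs_of_pos half_gt_zero_iff linorder_not_less zero_less_one)
  then have y: "1/2 \<le> y" "y \<le> 3/2" by linarith+
  have xy: "x = y powr (2 / a)" using assms(2) x by (simp add: y_def powr_powr)
  have "(1/2) powr (2 / a) \<le> x" "x \<le> (3/2) powr (2 / a)"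
    unfolding xy using y assms by (auto intro!: powr_mono2)
  moreover have "f x \<le> x powr r" unfolding f by (simp add: mult_left_le)
  moreover have "x powr r \<le> ((3/2) powr (2 / a)) powr r"
    using calculation x assms by (intro powr_mono2) auto
  ultimately show "(1/2) powr (2 / a) \<le> x \<and> x \<le> (3/2) powr (2 / a) \<and> f x \<le> ((3/2) powr (2 / a)) powr r"
    by linarith
qed auto

section \<open>Contradiction from the growth at small sizes\<close>

theorem theorem1p4:
  fixes \<gamma> \<theta> T :: real
  assumes "\<gamma> < 0" and "\<theta> > 1" and "T > 0"
  shows "\<not> (\<exists>v :: real \<Rightarrow> real measure.
           nonneg_weak_solution \<gamma> \<theta> 0 T v \<and>
           (\<exists>\<rho>>1 - \<gamma>.
              weak_star_tendsto \<rho> (\<rho> - \<gamma>) v dirac_one (at_right 0) \<and>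
              (\<exists>\<delta>>0. v \<in> C_moment {0..<T} (\<rho> - 1 - \<delta>) \<inter> C_moment {0..<T} (\<rho> - \<gamma> - 1 + \<delta>))))"
proof (rule notI, elim exE conjE IntE)
  fix v :: "real \<Rightarrow> real measure" and \<rho> \<delta> :: real
  assume sol: "nonneg_weak_solution \<gamma> \<theta> 0 T v" and \<rho>: "\<rho> > 1 - \<gamma>" and \<delta>: "\<delta> > 0"
    and init: "weak_star_tendsto \<rho> (\<rho> - \<gamma>) v dirac_one (at_right 0)"
    and v: "v \<in> C_moment {0..<T} (\<rho> - \<gamma> - 1 + \<delta>)"
  define s where "s = \<rho> - \<gamma> - 1 + \<delta>"
  have s: "0 < s" "\<gamma> - 1 \<le> s" using \<rho> \<delta> assms(1) by (auto simp: s_def)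
  note v = v[folded s_def]
  \<comment> \<open>By \<open>powr_in_E\<close>, the powers \<open>x powr q\<close> with
    \<open>r \<le> q \<le> r + a\<close> lie in \<open>E \<rho> (\<rho> - \<gamma>)\<close>; the
    exponents in \<open>f\<close> are the ends and the midpoint of this range.\<close>
  define r where "r = \<rho> - 1"
  define a where "a = - \<gamma>"
  have ra: "0 < r" "0 < a" using \<rho> assms(1) by (auto simp: r_def a_def)

  \<comment> \<open>Mass near \<open>1\<close> at small times\<close>
  define f where "f = (\<lambda>x. 8 * x powr (r + a / 2) - 3 * x powr r - 4 * x powr (r + a))"
  obtain k1 k2 where k: "0 < k1" "0 < k2"
    and f: "\<And>x. 0 < x \<Longrightarrow> 0 < f x \<Longrightarrow> k1 \<le> x \<and> x \<le> k2 \<and> f x \<le> k2 powr r"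
    using bump_of_powers[OF ra] unfolding f_def by blast
  have pw: "((\<lambda>t. \<integral>x. x powr q \<partial>(v t)) \<longlongrightarrow> 1) (at_right 0)"
      "\<forall>\<^sub>F t in at_right 0. integrable (v t) (\<lambda>x. x powr q)" if "r \<le> q" "q \<le> r + a" for q
    using that by (auto intro!: weak_star_tendsto_moment[OF init] simp: r_def a_def)
  \<comment> \<open>All three moments tend to \<open>1\<close>, so the integral of \<open>f\<close>
    tends to \<open>8 - 3 - 4 = 1\<close> and eventually exceeds \<open>1/2\<close>.\<close>
  have f_int: "\<forall>\<^sub>F t in at_right 0. integrable (v t) f \<and> 1 / 2 < (\<integral>x. f x \<partial>(v t))"
  proof -
    have ints: "\<forall>\<^sub>F t in at_right 0. integrable (v t) (\<lambda>x. x powr r) \<and>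
        integrable (v t) (\<lambda>x. x powr (r + a / 2)) \<and> integrable (v t) (\<lambda>x. x powr (r + a))"
      using ra by (intro eventually_conj pw) auto
    have "((\<lambda>t. 8 * (\<integral>x. x powr (r + a / 2) \<partial>(v t)) - 3 * (\<integral>x. x powr r \<partial>(v t))
        - 4 * (\<integral>x. x powr (r + a) \<partial>(v t))) \<longlongrightarrow> 8 * 1 - 3 * 1 - 4 * 1) (at_right 0)"
      using ra by (intro tendsto_intros pw) auto
    then have "\<forall>\<^sub>F t in at_right 0. 1 / 2 < 8 * (\<integral>x. x powr (r + a / 2) \<partial>(v t))
        - 3 * (\<integral>x. x powr r \<partial>(v t)) - 4 * (\<integral>x. x powr (r + a) \<partial>(v t))"
      by (rule order_tendstoD) simp
    with ints show ?thesis
      by eventually_elim (simp add: f_def)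
  qed
  obtain t0 where t0: "0 < t0" "t0 < T"
    and f_lower: "\<And>t. 0 < t \<Longrightarrow> t < t0 \<Longrightarrow> integrable (v t) f \<and> 1 / 2 < (\<integral>x. f x \<partial>(v t))"
  proof -
    obtain b where "0 < b" "\<And>t. 0 < t \<Longrightarrow> t < b \<Longrightarrow> integrable (v t) f \<and> 1 / 2 < (\<integral>x. f x \<partial>(v t))"
      using f_int unfolding eventually_at_right_field by auto
    then show ?thesis using that[of "min b (T / 2)"] \<open>T > 0\<close> by auto
  qed
  \<comment> \<open>Time is split in two: up to \<open>t1\<close> the fragments of the mass near
    \<open>1\<close> seed the small sizes, and from \<open>t1\<close> to \<open>t0\<close> the seed
    grows exponentially.\<close>
  define t1 where "t1 = t0 / 2"
  have t1: "0 < t1" "t1 < t0" using t0 by (auto simp: t1_def)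

  \<comment> \<open>The bump and the constants\<close>
  obtain \<psi> \<psi>' :: "real \<Rightarrow> real" and R \<mu> m where R: "R > 1" and \<mu>: "\<mu> > 0" and m: "m > 0"
    and psi: "\<And>x. (\<psi> has_real_derivative \<psi>' x) (at x)" "continuous_on UNIV \<psi>'"
    and psi_nonneg: "\<And>x. 0 \<le> \<psi> x" and psi_supp: "\<And>x. x \<notin> {1..R} \<Longrightarrow> \<psi> x = 0"
    and psi_mass: "\<And>x. R \<le> x \<Longrightarrow> (LBINT z:{0<..<x}. \<psi> z) = m"
    and psi_sub: "\<And>x. 0 < x \<Longrightarrow> \<mu> * \<psi> x \<le> x * \<psi>' x - \<psi> x + \<theta> / x * (LBINT z:{0<..<x}. \<psi> z)"
    by (rule fragmentation_subsolution[OF \<open>\<theta> > 1\<close>]) (erule that, assumption+)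
  have psic: "continuous_on S \<psi>" for S
    by (meson DERIV_continuous_on psi has_field_derivative_at_within)
  have psi'_0: "\<psi>' x = 0" if "R < x" for x
  proof -
    have "((\<lambda>_. 0) has_real_derivative \<psi>' x) (at x)"
      by (rule has_field_derivative_transform_within_open[OF psi(1), where S = "{R<..}"])
        (use that psi_supp in auto)
    then show ?thesis using DERIV_unique DERIV_const by blast
  qed
  obtain M where M: "0 \<le> M" "\<And>x. 0 < x \<Longrightarrow> \<bar>\<psi> x\<bar> \<le> M * x powr s"
    by (rule powr_dominated[of \<psi> 1 R 0 s]) (use psi_supp psic in auto)

  \<comment> \<open>\<open>c0\<close> compares the lower bound
    \<open>\<theta> * m * \<epsilon> * k2 powr (\<gamma> - 1)\<close> for the fragmentation gain
    with the upper bound \<open>k2 powr r\<close> for \<open>f\<close>, both where \<open>f\<close>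
    is positive. \<open>\<kappa>\<close> is the growth exponent over the second time span without
    its factor \<open>\<epsilon> powr \<gamma>\<close>, and \<open>K\<close> is the moment bound at
    \<open>t0\<close> divided by the seed, stripped of powers of \<open>\<epsilon>\<close>.\<close>
  define c0 where "c0 = \<theta> * m * k2 powr (\<gamma> - 1) / k2 powr r"
  have c0: "c0 > 0" using assms m k by (simp add: c0_def)
  define \<kappa> where "\<kappa> = \<mu> * R powr \<gamma> * (t0 - t1)"
  have \<kappa>: "\<kappa> > 0" using \<mu> R t0 t1 by (simp add: \<kappa>_def)
  define K where "K = M * (\<integral>x. x powr s \<partial>(v t0)) / (c0 * t1 / 4)"

  \<comment> \<open>Lower and upper estimates at scale \<open>\<epsilon>\<close>\<close>
  have bound: "exp (\<kappa> * \<epsilon> powr \<gamma>) * \<epsilon> powr (s + 1) \<le> K"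
    if \<epsilon>: "0 < \<epsilon>" "\<epsilon> < k1 / R" for \<epsilon>
  proof -
    define A where "A = (\<lambda>t. \<integral>x. \<psi> (x / \<epsilon>) \<partial>(v t))"
    define L where "L = (\<lambda>x. x powr (\<gamma> + 1) * (\<psi>' (x / \<epsilon>) / \<epsilon>) - x powr \<gamma> * \<psi> (x / \<epsilon>)
      + \<theta> * (x powr (\<gamma> - 1) * (LBINT z:{0<..<x}. \<psi> (z / \<epsilon>))))"
    define B where "B = (\<lambda>t. \<integral>x. L x \<partial>(v t))"
    have d: "((\<lambda>x. \<psi> (x / \<epsilon>)) has_real_derivative \<psi>' (x / \<epsilon>) / \<epsilon>) (at x)" for x
    proof -
      have "((\<lambda>x. x / \<epsilon>) has_real_derivative 1 / \<epsilon>) (at x)"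
        using \<epsilon> by (auto intro!: derivative_eq_intros)
      from DERIV_chain2[OF psi(1) this] show ?thesis by simp
    qed
    have dc: "continuous_on UNIV (\<lambda>x. \<psi>' (x / \<epsilon>) / \<epsilon>)"
      using \<epsilon> by (intro continuous_intros continuous_on_compose2[OF psi(2)]) auto
    have ds: "\<psi> (x / \<epsilon>) = 0" if "x \<notin> {\<epsilon>..R * \<epsilon>}" for x
      by (rule psi_supp) (use that \<epsilon> in \<open>auto simp: field_simps\<close>)
    have AB: "(A has_real_derivative B t) (at t)"
      and A_int: "integrable (v t) (\<lambda>x. \<psi> (x / \<epsilon>))" and B_int: "integrable (v t) L"
      if "0 < t" "t < T" for t
    proof -
      have "t \<in> {0<..<T}" using that by simp
      note * = weak_solution_moment_derivative[OF sol v s(2) d dc ds \<epsilon>(1) this]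
      show "(A has_real_derivative B t) (at t)" unfolding A_def B_def L_def by (rule *)
      show "integrable (v t) (\<lambda>x. \<psi> (x / \<epsilon>))" by (rule *)
      show "integrable (v t) L" unfolding L_def by (rule *)
    qed
    \<comment> \<open>Homogeneity of degree \<open>\<gamma>\<close>: the parenthesis is the right
      side of \<open>psi_sub\<close> at \<open>x / \<epsilon>\<close>, so one bump serves all
      scales.\<close>
    have L_eq: "L x = x powr \<gamma> * (x / \<epsilon> * \<psi>' (x / \<epsilon>) - \<psi> (x / \<epsilon>)
        + \<theta> / (x / \<epsilon>) * (LBINT z:{0<..<x / \<epsilon>}. \<psi> z))" if "0 < x" for x
      using that \<epsilon> by (simp add: L_def set_integral_scale powr_add powr_diff field_simps)
    \<comment> \<open>As \<open>\<gamma> < 0\<close>, the factor \<open>x powr \<gamma>\<close> is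
      smallest at the right end of the support \<open>{\<epsilon>..R * \<epsilon>}\<close>, which
      fixes the rate.\<close>
    define \<nu> where "\<nu> = \<mu> * (R * \<epsilon>) powr \<gamma>"
    have \<nu>: "\<nu> > 0" using \<mu> R \<epsilon> by (simp add: \<nu>_def)
    have L_growth: "\<nu> * \<psi> (x / \<epsilon>) \<le> L x" if x: "0 < x" for x
    proof -
      have "\<nu> * \<psi> (x / \<epsilon>) \<le> x powr \<gamma> * (\<mu> * \<psi> (x / \<epsilon>))"
      proof (cases "x \<le> R * \<epsilon>")
        case True
        have "(R * \<epsilon>) powr \<gamma> \<le> x powr \<gamma>"
          using True x assms(1) by (intro powr_mono2') auto
        then have "(R * \<epsilon>) powr \<gamma> * (\<mu> * \<psi> (x / \<epsilon>)) \<le> x powr \<gamma> * (\<mu> * \<psi> (x / \<epsilon>))"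
          using \<mu> psi_nonneg by (intro mult_right_mono) auto
        then show ?thesis by (simp add: \<nu>_def mult_ac)
      qed (simp add: ds)
      also have "\<dots> \<le> L x"
        unfolding L_eq[OF x] using psi_sub[of "x / \<epsilon>"] x \<epsilon> by (intro mult_left_mono) auto
      finally show ?thesis .
    qed
    have L_nonneg: "0 \<le> L x" if "0 < x" for x
    proof -
      have "0 \<le> \<nu> * \<psi> (x / \<epsilon>)" using \<nu> psi_nonneg by simp
      then show ?thesis using L_growth[OF that] by linarith
    qed
    have L_seed: "c0 * \<epsilon> * f x \<le> L x" if x: "0 < x" for x
    proof (cases "0 < f x")
      case False
      then have "c0 * \<epsilon> * f x \<le> 0" using c0 \<epsilon> by (simp add: mult_le_0_iff)
      then show ?thesis using L_nonneg[OF x] by linarith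
    next
      case True
      from f[OF x True] have fx: "k1 \<le> x" "x \<le> k2" "f x \<le> k2 powr r" by auto
      \<comment> \<open>This is where \<open>\<epsilon> < k1 / R\<close> enters: the rescaled bump
        ends to the left of \<open>k1\<close>, so the local terms vanish at \<open>x\<close> and the
        primitive has reached its full value \<open>m * \<epsilon>\<close>.\<close>
      have "R < x / \<epsilon>" using \<epsilon> fx R by (simp add: field_simps)
      then have "L x = \<theta> * m * \<epsilon> * x powr (\<gamma> - 1)"
        using psi_supp[of "x / \<epsilon>"] psi'_0[of "x / \<epsilon>"] psi_mass[of "x / \<epsilon>"] x \<epsilon>
        by (simp add: L_eq powr_diff)
      moreover have "k2 powr (\<gamma> - 1) \<le> x powr (\<gamma> - 1)"
        using x fx assms by (intro powr_mono2') auto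
      then have "\<theta> * m * \<epsilon> * k2 powr (\<gamma> - 1) \<le> \<theta> * m * \<epsilon> * x powr (\<gamma> - 1)"
        using assms m \<epsilon> by (intro mult_left_mono) auto
      moreover have "c0 * \<epsilon> * f x \<le> c0 * \<epsilon> * k2 powr r"
        using c0 \<epsilon> fx by (intro mult_left_mono) auto
      moreover have "c0 * \<epsilon> * k2 powr r = \<theta> * m * \<epsilon> * k2 powr (\<gamma> - 1)"
        using k by (simp add: c0_def)
      ultimately show ?thesis by linarith
    qed
    have sp: "x > 0" if "x \<in> space (v t)" "0 < t" "t < T" for x t
    proof -
      have "sets (v t) = sets half_line" using sol that by (auto simp: nonneg_weak_solution_def)
      then show ?thesis using space_eq_half_line that(1) by auto
    qed
    have B_growth: "\<nu> * A t \<le> B t" if "0 < t" "t < T" for t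
    proof -
      have "(\<integral>x. \<nu> * \<psi> (x / \<epsilon>) \<partial>(v t)) \<le> B t" unfolding B_def
        by (rule integral_mono) (use that A_int B_int L_growth sp in auto)
      then show ?thesis by (simp add: A_def)
    qed
    have B_seed: "c0 * \<epsilon> / 2 \<le> B t" if "0 < t" "t < t0" for t
    proof -
      have tT: "t < T" using that t0 by simp
      have "(\<integral>x. c0 * \<epsilon> * f x \<partial>(v t)) \<le> B t" unfolding B_def
        by (rule integral_mono) (use that tT f_lower[OF that] B_int L_seed sp in auto)
      moreover have "c0 * \<epsilon> * (1 / 2) \<le> c0 * \<epsilon> * (\<integral>x. f x \<partial>(v t))"
        using f_lower[OF that] c0 \<epsilon> by (intro mult_left_mono) auto
      ultimately show ?thesis by simp
    qed
    have A_nonneg: "0 \<le> A t" for t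
      unfolding A_def by (rule Bochner_Integration.integral_nonneg) (rule psi_nonneg)
    \<comment> \<open>The lower bound on \<open>B\<close> is integrated over
      \<open>{t1/2..t1}\<close>, as the differential equation is available at positive times only;
      at \<open>t1 / 2\<close> it suffices that \<open>A\<close> is nonnegative.\<close>
    have A1: "c0 * t1 / 4 * \<epsilon> \<le> A t1"
    proof -
      have "A (t1 / 2) - c0 * \<epsilon> / 2 * (t1 / 2) \<le> A t1 - c0 * \<epsilon> / 2 * t1"
      proof (rule DERIV_nonneg_imp_nondecreasing[where f = "\<lambda>t. A t - c0 * \<epsilon> / 2 * t"])
        fix t assume t: "t1 / 2 \<le> t" "t \<le> t1"
        have "((\<lambda>t. A t - c0 * \<epsilon> / 2 * t) has_real_derivative B t - c0 * \<epsilon> / 2) (at t)"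
          using t t0 t1 by (auto intro!: derivative_eq_intros AB)
        then show "\<exists>y. ((\<lambda>t. A t - c0 * \<epsilon> / 2 * t) has_real_derivative y) (at t) \<and> 0 \<le> y"
          using B_seed[of t] t t0 t1 by force
      qed (use t0 t1 in auto)
      then show ?thesis using A_nonneg[of "t1 / 2"] by (simp add: algebra_simps)
    qed
    \<comment> \<open>Gronwall's argument: with this integrating factor, \<open>B_growth\<close>
      makes the product nondecreasing.\<close>
    have "exp (- \<nu> * t1) * A t1 \<le> exp (- \<nu> * t0) * A t0"
    proof (rule DERIV_nonneg_imp_nondecreasing[where f = "\<lambda>t. exp (- \<nu> * t) * A t"])
      fix t assume t: "t1 \<le> t" "t \<le> t0"
      have "((\<lambda>t. exp (- \<nu> * t) * A t) has_real_derivative exp (- \<nu> * t) * (B t - \<nu> * A t)) (at t)"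
        using t t0 t1 by (auto intro!: derivative_eq_intros AB simp: algebra_simps)
      moreover have "0 \<le> exp (- \<nu> * t) * (B t - \<nu> * A t)"
        using B_growth[of t] t t0 t1 by auto
      ultimately show "\<exists>y. ((\<lambda>t. exp (- \<nu> * t) * A t) has_real_derivative y) (at t) \<and> 0 \<le> y"
        by blast
    qed (use t0 t1 in auto)
    then have "exp (\<nu> * t0) * (exp (- \<nu> * t1) * A t1) \<le> exp (\<nu> * t0) * (exp (- \<nu> * t0) * A t0)"
      by (intro mult_left_mono) auto
    moreover have "exp (\<nu> * t0) * (exp (- \<nu> * t1) * A t1) = exp (\<nu> * (t0 - t1)) * A t1"
      by (simp add: right_diff_distrib exp_diff exp_minus divide_inverse)
    moreover have "exp (\<nu> * t0) * (exp (- \<nu> * t0) * A t0) = A t0"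
      by (simp add: exp_minus)
    ultimately have "exp (\<nu> * (t0 - t1)) * A t1 \<le> A t0" by (simp only:)
    also have "\<nu> * (t0 - t1) = \<kappa> * \<epsilon> powr \<gamma>"
      using R \<epsilon> by (simp add: \<nu>_def \<kappa>_def powr_mult)
    finally have "exp (\<kappa> * \<epsilon> powr \<gamma>) * A t1 \<le> A t0" .
    moreover have "exp (\<kappa> * \<epsilon> powr \<gamma>) * (c0 * t1 / 4 * \<epsilon>) \<le> exp (\<kappa> * \<epsilon> powr \<gamma>) * A t1"
      by (intro mult_left_mono A1) auto
    moreover have "A t0 \<le> M * \<epsilon> powr (- s) * (\<integral>x. x powr s \<partial>(v t0))"
    proof -
      have "v t0 \<in> moment_space s" using v t0 t1 by (auto simp: C_moment_def)
      then have i: "integrable (v t0) (\<lambda>x. x powr s)"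
        by (rule integrable_moment_space[where C = 1]) (auto intro!: continuous_intros)
      \<comment> \<open>Rescaling the bound by \<open>M * x powr s\<close> costs only the power
        \<open>\<epsilon> powr (- s)\<close>, against an exponential lower bound.\<close>
      have "A t0 \<le> (\<integral>x. M * \<epsilon> powr (- s) * x powr s \<partial>(v t0))" unfolding A_def
      proof (rule integral_mono)
        fix x assume "x \<in> space (v t0)"
        then have x: "x > 0" using sp t0 t1 by auto
        have "\<psi> (x / \<epsilon>) \<le> M * (x / \<epsilon>) powr s" using M(2)[of "x / \<epsilon>"] x \<epsilon> by auto
        also have "\<dots> = M * \<epsilon> powr (- s) * x powr s"
          using x \<epsilon> by (simp add: powr_divide powr_minus field_simps)
        finally show "\<psi> (x / \<epsilon>) \<le> M * \<epsilon> powr (- s) * x powr s" .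
      qed (use A_int t0 t1 i in auto)
      then show ?thesis by simp
    qed
    ultimately have "exp (\<kappa> * \<epsilon> powr \<gamma>) * (c0 * t1 / 4 * \<epsilon>) \<le> M * \<epsilon> powr (- s) * (\<integral>x. x powr s \<partial>(v t0))"
      by linarith
    then have "exp (\<kappa> * \<epsilon> powr \<gamma>) * (c0 * t1 / 4 * \<epsilon>) * \<epsilon> powr s
        \<le> M * \<epsilon> powr (- s) * (\<integral>x. x powr s \<partial>(v t0)) * \<epsilon> powr s"
      by (intro mult_right_mono) auto
    also have "\<dots> = M * (\<integral>x. x powr s \<partial>(v t0))" using \<epsilon> by (simp add: powr_minus)
    finally show ?thesis
      using c0 t0 t1 \<epsilon> unfolding K_def by (subst pos_le_divide_eq) (simp_all add: powr_add algebra_simps)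
  qed

  \<comment> \<open>The limit \<open>\<epsilon> \<rightarrow> 0\<close>\<close>
  have "\<forall>\<^sub>F \<epsilon> in at_right 0. K < exp (\<kappa> * \<epsilon> powr \<gamma>) * \<epsilon> powr (s + 1)"
    using filterlim_exp_powr_mult_powr[OF \<kappa> assms(1), of "s + 1"] unfolding filterlim_at_top_dense by blast
  moreover have "\<forall>\<^sub>F \<epsilon> in at_right 0. 0 < \<epsilon> \<and> \<epsilon> < k1 / R"
    unfolding eventually_at_right_field using k R by (intro exI[of _ "k1 / R"]) auto
  ultimately have "\<forall>\<^sub>F \<epsilon>::real in at_right 0. False"
    by eventually_elim (use bound in force)
  then show False by simp
qed

end
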